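(* Let $\alpha\in(-\pi/2,\pi/2)$, let $\Omega\in\mathbb{R}$, $T>0$, and let $z(x,t)=a(x,t)e^{i\Omega t}$ be a solution of $$\frac{dz}{dt}=\frac12 e^{-i\alpha}\mathcal{G}z-\frac12 e^{i\alpha}z^2\,\mathcal{G}\overline{z},$$ where $a(x,t)$ is continuous, $2\pi$-periodic in $x$ and $T$-periodic in $t$. Let $\eta(x,t)=i\Omega+e^{i\alpha}a(x,t)(\mathcal{G}\overline{a})(x,t)$, and let $\mathcal{E}(T)$ be the monodromy operator on $C_{\mathrm{per}}([-\pi,\pi];\mathbb{C}^2)$ defined in the context. Then the essential spectrum of $\mathcal{E}(T)$ is $$\sigma_{\mathrm{ess}}=\left\{\exp\left(-\int_0^T\eta(x,t)\,dt\right): x\in[-\pi,\pi]\right\}\cup\left\{\exp\left(-\int_0^T\overline{\eta}(x,t)\,dt\right): x\in[-\pi,\pi]\right\}.$$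
   Context: The coupling kernel $G:\mathbb{R}\to\mathbb{R}$ is a nonconstant continuous even $2\pi$-periodic function, and $(\mathcal{G}u)(x)=\int_{-\pi}^{\pi}G(x-y)u(y)\,dy$ (acting in $x$). $C_{\mathrm{per}}([-\pi,\pi];\mathbb{C}^2)$ is the Banach space of continuous $2\pi$-periodic $\mathbb{C}^2$-valued functions with the sup norm. For each $t$ define bounded linear operators on this space, acting on $V=(v_1,v_2)^{\mathrm T}$, by $$\mathcal{A}(t)V=\begin{pmatrix}-\eta(\cdot,t)v_1\\ -\overline{\eta}(\cdot,t)v_2\end{pmatrix},\qquad \mathcal{B}(t)V=\frac12\begin{pmatrix}e^{-i\alpha}&-e^{i\alpha}a^2(\cdot,t)\\ -e^{-i\alpha}\overline{a}^2(\cdot,t)&e^{i\alpha}\end{pmatrix}\begin{pmatrix}\mathcal{G}v_1\\ \mathcal{G}v_2\end{pmatrix}.$$ $\mathcal{E}(t)$ is the evolution operator of $\frac{dV}{dt}=\mathcal{A}(t)V+\mathcal{B}(t)V$: the solution with $V(0)=V_0$ is $V(t)=\mathcal{E}(t)V_0$. The monodromy operator is $\mathcal{E}(T)$. The essential spectrum of a bounded operator $\mathcal{L}$ is the set of $\mu\in\mathbb{C}$ for which $\mathcal{L}-\mu\mathcal{I}$ is not a Fredholm operator of index zero. *)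

theory Defs
  imports "HOL-Analysis.Analysis"
begin

section \<open>Complex Banach spaces, Fredholm operators and the essential spectrum\<close>

text \<open>HOL-Analysis has no type class of complex normed spaces, so the complex
  multiplication is an explicit parameter extending the real one.
  All spans, dimensions and subspaces below are over the complex numbers.\<close>

locale complex_banach_space = vector_space scale
  for scale :: "complex \<Rightarrow> 'a::banach \<Rightarrow> 'a" +
  assumes scale_of_real: "scale (of_real r) v = r *\<^sub>R v"
    and norm_scale: "norm (scale c v) = norm c * norm v"
begin

definition finite_dim :: "'a set \<Rightarrow> bool" where
  "finite_dim S \<longleftrightarrow> (\<exists>B. finite B \<and> span B = S)"

definition complementary :: "'a set \<Rightarrow> 'a set \<Rightarrow> bool" where
  "complementary S W \<longleftrightarrow>
     subspace W \<and> S \<inter> W = {0} \<and> (\<forall>v. \<exists>s\<in>S. \<exists>w\<in>W. v = s + w)"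

definition finite_codim :: "'a set \<Rightarrow> bool" where
  "finite_codim S \<longleftrightarrow> (\<exists>W. complementary S W \<and> finite_dim W)"

text \<open>The choice is immaterial: every algebraic complement of a subspace is isomorphic to
  the quotient by it.\<close>

definition codim :: "'a set \<Rightarrow> nat" where
  "codim S = dim (SOME W. complementary S W)"

definition kernel :: "('a \<Rightarrow> 'a) \<Rightarrow> 'a set" where
  "kernel L = {v. L v = 0}"

definition fredholm :: "('a \<Rightarrow> 'a) \<Rightarrow> bool" where
  "fredholm L \<longleftrightarrow>
     bounded_linear L \<and> (\<forall>c v. L (scale c v) = scale c (L v)) \<and>
     finite_dim (kernel L) \<and> closed (range L) \<and> finite_codim (range L)"

definition fredholm_index :: "('a \<Rightarrow> 'a) \<Rightarrow> int" where
  "fredholm_index L = int (dim (kernel L)) - int (codim (range L))"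

definition essential_spectrum :: "('a \<Rightarrow> 'a) \<Rightarrow> complex set" where
  "essential_spectrum L =
     {\<mu>. \<not> (fredholm (\<lambda>v. L v - scale \<mu> v) \<and> fredholm_index (\<lambda>v. L v - scale \<mu> v) = 0)}"

end


section \<open>Evolution operators\<close>

definition solves_linear_ode ::
  "(real \<Rightarrow> 'a \<Rightarrow> 'a) \<Rightarrow> 'a \<Rightarrow> (real \<Rightarrow> 'a::real_normed_vector) \<Rightarrow> bool" where
  "solves_linear_ode L V0 V \<longleftrightarrow>
     V 0 = V0 \<and> (\<forall>t. (V has_vector_derivative L t (V t)) (at t))"

definition evolution_operator ::
  "(real \<Rightarrow> 'a \<Rightarrow> 'a) \<Rightarrow> real \<Rightarrow> 'a \<Rightarrow> 'a::real_normed_vector" where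
  "evolution_operator L t V0 = (THE V. solves_linear_ode L V0 V) t"


section \<open>The space of continuous periodic functions\<close>

typedef cper = "{f :: real \<Rightarrow> complex \<times> complex.
    continuous_on UNIV f \<and> (\<forall>x. f (x + 2 * pi) = f x)}"
  morphisms apply_cper Abs_cper
  by (rule exI[of _ "\<lambda>_. 0"]) auto

setup_lifting type_definition_cper

lemma periodic_shift_int:
  fixes f :: "real \<Rightarrow> 'a"
  assumes per: "\<And>x. f (x + p) = f x"
  shows "f (x + of_int k * p) = f x"
proof -
  have nat: "f (x + of_nat n * p) = f x" for n x
  proof (induction n)
    case (Suc n)
    have "x + of_nat (Suc n) * p = (x + of_nat n * p) + p"
      by (simp add: algebra_simps)
    then show ?case using per Suc by metis
  qed simp
  show ?thesis
  proof (cases "k \<ge> 0")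
    case True
    then show ?thesis using nat[of x "nat k"] by simp
  next
    case False
    then have "f (x + of_int k * p) = f ((x + of_int k * p) + of_nat (nat (- k)) * p)"
      using nat by metis
    also have "(x + of_int k * p) + of_nat (nat (- k)) * p = x"
      using False by (simp add: algebra_simps)
    finally show ?thesis .
  qed
qed

lemma periodic_obtain:
  fixes f :: "real \<Rightarrow> 'a"
  assumes per: "\<And>x. f (x + 2 * pi) = f x"
  obtains y where "y \<in> {-pi..pi}" "f x = f y"
proof
  let ?k = "- \<lfloor>(x + pi) / (2 * pi)\<rfloor>"
  let ?y = "x + of_int ?k * (2 * pi)"
  show "f x = f ?y" using periodic_shift_int[of f "2 * pi", OF per] by metis
  have a: "of_int (- ?k) \<le> (x + pi) / (2 * pi)" "(x + pi) / (2 * pi) < of_int (- ?k) + 1"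
    by linarith+
  have "of_int (- ?k) * (2 * pi) \<le> x + pi" "x + pi < (of_int (- ?k) + 1) * (2 * pi)"
    using iffD1[OF pos_le_divide_eq a(1)] iffD1[OF pos_divide_less_eq a(2)] by simp_all
  then show "?y \<in> {-pi..pi}" by (auto simp: algebra_simps)
qed

lemma apply_cper_continuous: "continuous_on S (apply_cper f)"
  using apply_cper[of f] continuous_on_subset by blast

lemma apply_cper_periodic: "apply_cper f (x + 2 * pi) = apply_cper f x"
  using apply_cper[of f] by auto

lemma cper_eqI: "(\<And>x. apply_cper f x = apply_cper g x) \<Longrightarrow> f = g"
  by (meson apply_cper_inject ext)

lemma bdd_above_apply_cper: "bdd_above (range (\<lambda>x. norm (apply_cper f x)))"
proof -
  have "compact ((\<lambda>x. norm (apply_cper f x)) ` {-pi..pi})"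
    by (intro compact_continuous_image continuous_intros apply_cper_continuous) auto
  then have "bdd_above ((\<lambda>x. norm (apply_cper f x)) ` {-pi..pi})"
    by (intro bounded_imp_bdd_above compact_imp_bounded)
  moreover have "range (\<lambda>x. norm (apply_cper f x)) \<subseteq> (\<lambda>x. norm (apply_cper f x)) ` {-pi..pi}"
  proof clarify
    fix x
    obtain y where "y \<in> {-pi..pi}" "apply_cper f x = apply_cper f y"
      using periodic_obtain[of "apply_cper f" x] apply_cper_periodic by blast
    then show "norm (apply_cper f x) \<in> (\<lambda>x. norm (apply_cper f x)) ` {-pi..pi}"
      by auto
  qed
  ultimately show ?thesis by (rule bdd_above_mono)
qed

instantiation cper :: real_normed_vector
begin

lift_definition zero_cper :: cper is "\<lambda>_. 0" by auto
lift_definition plus_cper :: "cper \<Rightarrow> cper \<Rightarrow> cper" is "\<lambda>f g x. f x + g x"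
  by (auto intro!: continuous_intros)
lift_definition minus_cper :: "cper \<Rightarrow> cper \<Rightarrow> cper" is "\<lambda>f g x. f x - g x"
  by (auto intro!: continuous_intros)
lift_definition uminus_cper :: "cper \<Rightarrow> cper" is "\<lambda>f x. - f x"
  by (auto intro!: continuous_intros)
lift_definition scaleR_cper :: "real \<Rightarrow> cper \<Rightarrow> cper" is "\<lambda>r f x. r *\<^sub>R f x"
  by (auto intro!: continuous_intros)

definition norm_cper :: "cper \<Rightarrow> real" where
  "norm_cper f = (SUP x. norm (apply_cper f x))"
definition dist_cper :: "cper \<Rightarrow> cper \<Rightarrow> real" where
  "dist_cper f g = norm (f - g)"
definition sgn_cper :: "cper \<Rightarrow> cper" where
  "sgn_cper f = inverse (norm f) *\<^sub>R f"
definition uniformity_cper :: "(cper \<times> cper) filter" where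
  "uniformity_cper = (INF e\<in>{0 <..}. principal {(f, g). dist f g < e})"
definition open_cper :: "cper set \<Rightarrow> bool" where
  "open_cper S = (\<forall>x\<in>S. \<forall>\<^sub>F (x', y) in uniformity. x' = x \<longrightarrow> y \<in> S)"

lemma norm_apply_cper_le: "norm (apply_cper f x) \<le> norm f"
  unfolding norm_cper_def by (rule cSUP_upper[OF _ bdd_above_apply_cper]) simp

lemma norm_cper_le: "(\<And>x. norm (apply_cper f x) \<le> b) \<Longrightarrow> norm f \<le> b"
  unfolding norm_cper_def by (rule cSUP_least) auto

instance
proof
  fix f g h :: cper and r s :: real
  show "f + g + h = f + (g + h)" "f + g = g + f" "0 + f = f" "- f + f = 0" "f - g = f + - g"
    "r *\<^sub>R (f + g) = r *\<^sub>R f + r *\<^sub>R g" "(r + s) *\<^sub>R f = r *\<^sub>R f + s *\<^sub>R f"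
    "r *\<^sub>R s *\<^sub>R f = (r * s) *\<^sub>R f" "1 *\<^sub>R f = f"
    by (transfer, simp add: algebra_simps)+
  show "norm f = 0 \<longleftrightarrow> f = 0"
  proof
    assume "norm f = 0"
    then have "apply_cper f x = 0" for x using norm_apply_cper_le[of f x] by simp
    then show "f = 0" by (intro cper_eqI) (simp add: zero_cper.rep_eq)
  qed (simp add: norm_cper_def zero_cper.rep_eq)
  show "norm (f + g) \<le> norm f + norm g"
    by (rule norm_cper_le)
      (metis add_mono norm_apply_cper_le norm_triangle_le plus_cper.rep_eq)
  have le: "norm (r *\<^sub>R f) \<le> \<bar>r\<bar> * norm f" for r :: real and f :: cper
    by (rule norm_cper_le) (simp add: scaleR_cper.rep_eq mult_left_mono norm_apply_cper_le)
  show "norm (r *\<^sub>R f) = \<bar>r\<bar> * norm f"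
  proof (cases "r = 0")
    case True
    then have "r *\<^sub>R f = 0" by (intro cper_eqI) (simp add: scaleR_cper.rep_eq zero_cper.rep_eq)
    then show ?thesis using True by (simp add: norm_cper_def zero_cper.rep_eq)
  next
    case False
    then have "f = inverse r *\<^sub>R (r *\<^sub>R f)"
      by (intro cper_eqI) (simp add: scaleR_cper.rep_eq)
    then have "norm f \<le> \<bar>inverse r\<bar> * norm (r *\<^sub>R f)" using le by metis
    then have "\<bar>r\<bar> * norm f \<le> norm (r *\<^sub>R f)"
      using False by (simp add: field_simps abs_inverse)
    then show ?thesis using le[of r f] by simp
  qed
qed (rule dist_cper_def sgn_cper_def uniformity_cper_def open_cper_def)+

end

instance cper :: banach
proof
  fix X :: "nat \<Rightarrow> cper"
  assume X: "Cauchy X"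
  have le: "dist (apply_cper f x) (apply_cper g x) \<le> dist f g" for f g x
    using norm_apply_cper_le[of "f - g" x] by (simp add: dist_norm minus_cper.rep_eq)
  have "uniformly_Cauchy_on UNIV (\<lambda>n. apply_cper (X n))"
    unfolding uniformly_Cauchy_on_def
  proof (intro allI impI)
    fix e :: real assume "e > 0"
    with X obtain M where "\<forall>m\<ge>M. \<forall>n\<ge>M. dist (X m) (X n) < e"
      unfolding Cauchy_def by blast
    with le show "\<exists>M. \<forall>x\<in>UNIV. \<forall>m\<ge>M. \<forall>n\<ge>M.
        dist (apply_cper (X m) x) (apply_cper (X n) x) < e"
      using order.strict_trans1 by (intro exI[of _ M]) blast
  qed
  then obtain l where l: "uniform_limit UNIV (\<lambda>n. apply_cper (X n)) l sequentially"
    using Cauchy_uniformly_convergent uniformly_convergent_on_def by blast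
  have cont: "continuous_on UNIV l"
    by (rule uniform_limit_theorem[OF _ l]) (auto intro!: always_eventually apply_cper_continuous)
  have lim: "(\<lambda>n. apply_cper (X n) x) \<longlonglongrightarrow> l x" for x
    using tendsto_uniform_limitI[OF l] by simp
  have "l (x + 2 * pi) = l x" for x
    by (rule LIMSEQ_unique[OF lim[of "x + 2 * pi", unfolded apply_cper_periodic] lim[of x]])
  with cont have rep: "apply_cper (Abs_cper l) = l"
    by (intro Abs_cper_inverse) auto
  have "X \<longlonglongrightarrow> Abs_cper l"
  proof (rule metric_LIMSEQ_I)
    fix e :: real assume e: "e > 0"
    then obtain N where N: "\<And>n x. n \<ge> N \<Longrightarrow> dist (apply_cper (X n) x) (l x) < e / 2"
      using l unfolding uniform_limit_sequentially_iff by (meson UNIV_I half_gt_zero)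
    have "dist (X n) (Abs_cper l) \<le> e / 2" if "n \<ge> N" for n
      unfolding dist_norm
      by (rule norm_cper_le) (use N[OF that] in \<open>auto simp: minus_cper.rep_eq rep dist_norm less_imp_le\<close>)
    then show "\<exists>N. \<forall>n\<ge>N. dist (X n) (Abs_cper l) < e" using e by force
  qed
  then show "convergent X" by (rule convergentI)
qed

lift_definition scaleC_cper :: "complex \<Rightarrow> cper \<Rightarrow> cper" is
  "\<lambda>c f x. (c * fst (f x), c * snd (f x))"
  by (auto intro!: continuous_intros)

interpretation cper: complex_banach_space scaleC_cper
proof
  fix c d :: complex and f g :: cper and r :: real
  show "scaleC_cper c (f + g) = scaleC_cper c f + scaleC_cper c g"
    "scaleC_cper (c + d) f = scaleC_cper c f + scaleC_cper d f"
    "scaleC_cper c (scaleC_cper d f) = scaleC_cper (c * d) f"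
    "scaleC_cper 1 f = f"
    by (transfer, simp add: algebra_simps)+
  show "scaleC_cper (of_real r) f = r *\<^sub>R f"
    by transfer (simp add: scaleR_prod_def scaleR_conv_of_real)
  have ptw: "norm (apply_cper (scaleC_cper c f) x) = norm c * norm (apply_cper f x)" for c f x
    by (simp add: scaleC_cper.rep_eq norm_prod_def norm_mult power_mult_distrib
        real_sqrt_mult flip: distrib_left)
  have le: "norm (scaleC_cper c f) \<le> norm c * norm f" for c f
    by (rule norm_cper_le) (simp add: ptw mult_left_mono norm_apply_cper_le)
  show "norm (scaleC_cper c f) = norm c * norm f"
  proof (cases "c = 0")
    case True
    then show ?thesis using le[of c f] by simp
  next
    case False
    then have "f = scaleC_cper (inverse c) (scaleC_cper c f)"
      by (intro cper_eqI) (simp add: scaleC_cper.rep_eq flip: mult.assoc)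
    then have "norm f \<le> norm (inverse c) * norm (scaleC_cper c f)" using le by metis
    then have "norm c * norm f \<le> norm (scaleC_cper c f)"
      using False by (simp add: field_simps norm_inverse norm_divide)
    then show ?thesis using le[of c f] by simp
  qed
qed


section \<open>The coupled oscillator equation and its linearization\<close>

definition coupling :: "(real \<Rightarrow> real) \<Rightarrow> (real \<Rightarrow> complex) \<Rightarrow> real \<Rightarrow> complex" where
  "coupling G u x = integral {-pi..pi} (\<lambda>y. of_real (G (x - y)) * u y)"

definition oscillator_solution ::
  "real \<Rightarrow> (real \<Rightarrow> real) \<Rightarrow> (real \<Rightarrow> real \<Rightarrow> complex) \<Rightarrow> bool" where
  "oscillator_solution \<alpha> G z \<longleftrightarrow>
     (\<forall>x t. ((\<lambda>s. z x s) has_vector_derivative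
         1/2 * exp (- \<i> * of_real \<alpha>) * coupling G (\<lambda>y. z y t) x
       - 1/2 * exp (\<i> * of_real \<alpha>) * (z x t)\<^sup>2 * coupling G (\<lambda>y. cnj (z y t)) x) (at t))"

definition eta ::
  "real \<Rightarrow> real \<Rightarrow> (real \<Rightarrow> real) \<Rightarrow> (real \<Rightarrow> real \<Rightarrow> complex) \<Rightarrow> real \<Rightarrow> real \<Rightarrow> complex" where
  "eta \<alpha> \<Omega> G a x t =
     \<i> * of_real \<Omega> + exp (\<i> * of_real \<alpha>) * a x t * coupling G (\<lambda>y. cnj (a y t)) x"

text \<open>\<open>Abs_cper\<close> is meaningful in the next two definitions only for continuous periodic
  coefficients; see \<open>apply_multiplication_part\<close> and \<open>apply_coupling_part\<close>.\<close>

definition multiplication_part ::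
  "(real \<Rightarrow> real \<Rightarrow> complex) \<Rightarrow> real \<Rightarrow> cper \<Rightarrow> cper" where
  "multiplication_part \<eta> t V =
     Abs_cper (\<lambda>x. (- \<eta> x t * fst (apply_cper V x), - cnj (\<eta> x t) * snd (apply_cper V x)))"

definition coupling_part ::
  "real \<Rightarrow> (real \<Rightarrow> real) \<Rightarrow> (real \<Rightarrow> real \<Rightarrow> complex) \<Rightarrow> real \<Rightarrow> cper \<Rightarrow> cper" where
  "coupling_part \<alpha> G a t V =
     Abs_cper (\<lambda>x.
       let g1 = coupling G (\<lambda>y. fst (apply_cper V y)) x;
           g2 = coupling G (\<lambda>y. snd (apply_cper V y)) x
       in (1/2 * (exp (- \<i> * of_real \<alpha>) * g1 - exp (\<i> * of_real \<alpha>) * (a x t)\<^sup>2 * g2),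
           1/2 * (- exp (- \<i> * of_real \<alpha>) * (cnj (a x t))\<^sup>2 * g1 + exp (\<i> * of_real \<alpha>) * g2)))"

definition monodromy ::
  "real \<Rightarrow> real \<Rightarrow> (real \<Rightarrow> real) \<Rightarrow> (real \<Rightarrow> real \<Rightarrow> complex) \<Rightarrow> real \<Rightarrow> cper \<Rightarrow> cper" where
  "monodromy \<alpha> \<Omega> G a T =
     evolution_operator
       (\<lambda>t V. multiplication_part (eta \<alpha> \<Omega> G a) t V + coupling_part \<alpha> G a t V) T"

lemma coupling_continuous:
  fixes u :: "real \<Rightarrow> real \<Rightarrow> complex"
  assumes G: "continuous_on UNIV G" and u: "continuous_on UNIV (\<lambda>(y, t). u y t)"
  shows "continuous_on UNIV (\<lambda>(x, t). coupling G (\<lambda>y. u y t) x)"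
proof -
  have "continuous_on (UNIV \<times> cbox (-pi) pi)
      (\<lambda>(p, y). of_real (G (fst p - y)) * u y (snd p) :: complex)"
    unfolding case_prod_beta
    by (intro continuous_intros continuous_on_compose2[OF G]
        continuous_on_compose2[OF u, of _ "\<lambda>q. (snd q, snd (fst q))", simplified]) auto
  then have "continuous_on UNIV
      (\<lambda>p. integral (cbox (-pi) pi) (\<lambda>y. of_real (G (fst p - y)) * u y (snd p) :: complex))"
    by (rule integral_continuous_on_param)
  then show ?thesis by (simp add: coupling_def case_prod_beta)
qed

lemma coupling_periodic:
  assumes "\<And>x. G (x + 2 * pi) = G x"
  shows "coupling G u (x + 2 * pi) = coupling G u x"
proof -
  have "G (x + 2 * pi - y) = G (x - y)" for y
    using assms[of "x - y"] by (simp add: algebra_simps)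
  then show ?thesis by (simp add: coupling_def)
qed

lemma eta_continuous:
  assumes "continuous_on UNIV G" and a: "continuous_on UNIV (\<lambda>(x, t). a x t)"
  shows "continuous_on UNIV (\<lambda>(x, t). eta \<alpha> \<Omega> G a x t)"
proof -
  have "continuous_on UNIV (\<lambda>(x, t). cnj (a x t))"
    using a unfolding case_prod_beta by (intro continuous_intros)
  then show ?thesis
    using coupling_continuous[of G "\<lambda>x t. cnj (a x t)"] assms
    unfolding eta_def case_prod_beta by (intro continuous_intros) auto
qed

lemma eta_periodic:
  assumes "\<And>x. G (x + 2 * pi) = G x" "\<And>x t. a (x + 2 * pi) t = a x t"
  shows "eta \<alpha> \<Omega> G a (x + 2 * pi) t = eta \<alpha> \<Omega> G a x t"
  by (simp add: eta_def assms coupling_periodic)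

lemma continuous_slice:
  assumes "continuous_on UNIV (\<lambda>(x, t). f x t)"
  shows "continuous_on S (\<lambda>x. f x t)"
proof -
  have "continuous_on S (\<lambda>x. (x, t))" by (intro continuous_intros)
  from continuous_on_compose2[OF assms this] show ?thesis by simp
qed

lemma apply_multiplication_part:
  assumes "continuous_on UNIV (\<lambda>(x, t). \<eta> x t)" "\<And>x t. \<eta> (x + 2 * pi) t = \<eta> x t"
  shows "apply_cper (multiplication_part \<eta> t V) x =
     (- \<eta> x t * fst (apply_cper V x), - cnj (\<eta> x t) * snd (apply_cper V x))"
  unfolding multiplication_part_def
  by (subst Abs_cper_inverse)
    (auto intro!: continuous_intros continuous_slice[OF assms(1)] apply_cper_continuous
      simp: apply_cper_periodic assms(2))

lemma apply_coupling_part: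
  assumes G: "continuous_on UNIV G" and per: "\<And>x. G (x + 2 * pi) = G x"
    and a: "continuous_on UNIV (\<lambda>(x, t). a x t)" "\<And>x t. a (x + 2 * pi) t = a x t"
  shows "apply_cper (coupling_part \<alpha> G a t V) x =
      (let g1 = coupling G (\<lambda>y. fst (apply_cper V y)) x;
           g2 = coupling G (\<lambda>y. snd (apply_cper V y)) x
       in (1/2 * (exp (- \<i> * of_real \<alpha>) * g1 - exp (\<i> * of_real \<alpha>) * (a x t)\<^sup>2 * g2),
           1/2 * (- exp (- \<i> * of_real \<alpha>) * (cnj (a x t))\<^sup>2 * g1 + exp (\<i> * of_real \<alpha>) * g2)))"
proof -
  have c: "continuous_on UNIV (coupling G (\<lambda>y. w (apply_cper V y)))"
    if "continuous_on UNIV w" for w :: "complex \<times> complex \<Rightarrow> complex"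
  proof -
    have "continuous_on UNIV (\<lambda>(y, s::real). w (apply_cper V y))"
      unfolding case_prod_beta
      by (intro continuous_on_compose2[OF that] continuous_on_compose2[OF apply_cper_continuous]
          continuous_intros) auto
    from continuous_slice[OF coupling_continuous[OF G this]] show ?thesis .
  qed
  note c1 = c[of fst, OF continuous_on_fst[OF continuous_on_id]]
    and c2 = c[of snd, OF continuous_on_snd[OF continuous_on_id]]
  show ?thesis
    unfolding coupling_part_def Let_def
    by (subst Abs_cper_inverse)
      (auto intro!: continuous_intros continuous_slice[OF a(1)] c1 c2
        simp: coupling_periodic per a(2))
qed

end

(* By variation of constants the monodromy operator is M + K, where M multiplies the two
   components by exp (- int eta) and exp (- int cnj eta), and |K f x - K f y| <= kappa x y * |f| for
   a continuous kappa vanishing on the diagonal.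

   If mu is not a value of a multiplier, M - mu is invertible. A partition of unity built from kappa
   approximates K in norm by finite rank operators, so M + K - mu is an invertible operator plus
   one of finite rank, hence Fredholm of index zero.

   If mu is the value of a multiplier at x0, then every function in the range of M + K - mu has at x0,
   in the corresponding component, a modulus of continuity O(w) for one fixed continuous w with
   w x0 = 0. Adding a finite-dimensional space only enlarges w, and sqrt w is never O(w), so the
   range has infinite codimension. *)

theory Submission
  imports Defs
begin

section \<open>Finite rank perturbations of invertible operators\<close>

text \<open>No theory of compact operators is used. For the identity plus a finite rank operator,
  index zero is rank-nullity inside one finite-dimensional space; the small remainder of the
  approximation of \<open>K\<close> is absorbed into the invertible part. At a value of a multiplier
  the kernel is a poor witness: it may well be trivial, for instance when the multiplier takes the
  value at isolated points only. Hence the argument looks at the range alone. The function sqrt w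
  works because w is fixed by mu, \<open>K\<close> and a finite spanning set of the supposed
  complement, before any preimage is chosen; the preimage enters only through the constant in O(w).
  The modulus kappa comes from Duhamel's formula: \<open>K f\<close> integrates the whole solution
  on [0, T] against a kernel continuous in x, so a bound of the solution by a multiple of |f| is all
  that has to be known about it. \<open>evolution_operator\<close> asks for solutions on the whole
  real line, in both time directions. This explains the two-sided weight exp (- 2 c |t|) and the
  need for coefficient bounds that hold for all t.\<close>

context complex_banach_space
begin

interpretation endo: vector_space_pair scale scale ..

section \<open>Complex-linear maps, finite spans and codimension\<close>

lemma linear_scaleI:
  assumes "\<And>u v. f (u + v) = f u + f v" "\<And>c v. f (scale c v) = scale c (f v)"
  shows "Vector_Spaces.linear scale scale f"
  by unfold_locales (fact assms)+

lemma bounded_linear_scale: "bounded_linear (scale c)"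
proof (rule bounded_linear_intro[where K = "norm c"])
  show "scale c (r *\<^sub>R v) = r *\<^sub>R scale c v" for r v
    by (metis scale_left_commute scale_of_real)
qed (simp_all add: scale_right_distrib norm_scale mult.commute)

lemma bounded_linear_scale_left: "bounded_linear (\<lambda>c. scale c v)"
proof (rule bounded_linear_intro[where K = "norm v"])
  show "scale (r *\<^sub>R c) v = r *\<^sub>R scale c v" for r c
    by (metis scale_scale scale_of_real scaleR_conv_of_real)
qed (simp_all add: scale_left_distrib norm_scale)

text \<open>A vector \<open>b\<close> outside the closed space \<open>span B\<close> has a positive
  distance \<open>d\<close> from it, which bounds its coefficient:
  \<open>norm c * d \<le> norm (scale c b + s)\<close>. In a convergent sequence of
  \<open>span (insert b B)\<close> the coefficients of \<open>b\<close> are therefore Cauchy, and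
  what is left converges inside \<open>span B\<close>.\<close>

lemma closed_span_finite:
  assumes "finite B"
  shows "closed (span B)"
  using assms
proof induction
  case (insert b B)
  show ?case
  proof (cases "b \<in> span B")
    case True
    then show ?thesis using insert by (simp add: span_redundant)
  next
    case False
    then have "b \<in> - span B" "open (- span B)" using insert.IH by auto
    then obtain d where "d > 0" and ball: "ball b d \<subseteq> - span B"
      using open_contains_ball by metis
    then have d: "d > 0" "\<And>s. s \<in> span B \<Longrightarrow> d \<le> dist b s"
      by (auto simp: subset_eq not_less[symmetric])
    have low: "norm c * d \<le> norm (scale c b + s)" if s: "s \<in> span B" for c s
    proof (cases "c = 0")
      case False
      have "scale c b + s = scale c (b - scale (- inverse c) s)"
        using False by (simp add: scale_right_distrib)
      then show ?thesis
        using d(2)[OF span_scale[OF s, of "- inverse c"]] by (simp add: norm_scale dist_norm mult_left_mono)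
    qed simp
    show ?thesis
      unfolding closed_sequential_limits
    proof (intro allI impI, elim conjE)
      fix X l assume X: "\<forall>n. X n \<in> span (insert b B)" and l: "X \<longlonglongrightarrow> l"
      then have "\<forall>n. \<exists>c. X n - scale c b \<in> span B"
        using span_breakdown_eq by blast
      then obtain c where c: "\<And>n. X n - scale (c n) b \<in> span B" by metis
      have "Cauchy c"
      proof (rule metric_CauchyI)
        fix e :: real assume "e > 0"
        then have "e * d > 0" using d by simp
        then obtain N where N: "\<And>m n. m \<ge> N \<Longrightarrow> n \<ge> N \<Longrightarrow> norm (X m - X n) < e * d"
          using LIMSEQ_imp_Cauchy[OF l] unfolding Cauchy_def dist_norm by meson
        have "norm (c m - c n) < e" if "m \<ge> N" "n \<ge> N" for m n
        proof -
          have "norm (c m - c n) * d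
              \<le> norm (scale (c m - c n) b + ((X m - scale (c m) b) - (X n - scale (c n) b)))"
            by (intro low span_diff c)
          also have "\<dots> = norm (X m - X n)"
            by (simp add: scale_left_diff_distrib algebra_simps)
          also have "\<dots> < e * d" using N that by blast
          finally show ?thesis using d(1) by simp
        qed
        then show "\<exists>M. \<forall>m\<ge>M. \<forall>n\<ge>M. dist (c m) (c n) < e"
          unfolding dist_norm by blast
      qed
      then obtain k where k: "c \<longlonglongrightarrow> k"
        using Cauchy_convergent convergent_def by blast
      have "(\<lambda>n. scale (c n - k) b) \<longlonglongrightarrow> 0"
      proof (rule tendsto_norm_zero_cancel)
        have "(\<lambda>n. norm (c n - k) * norm b) \<longlonglongrightarrow> norm (k - k) * norm b"
          by (intro tendsto_intros k)
        then show "(\<lambda>n. norm (scale (c n - k) b)) \<longlonglongrightarrow> 0"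
          by (simp add: norm_scale)
      qed
      then have "(\<lambda>n. X n - scale k b - scale (c n - k) b) \<longlonglongrightarrow> l - scale k b - 0"
        by (intro tendsto_intros l)
      then have "(\<lambda>n. X n - scale (c n) b) \<longlonglongrightarrow> l - scale k b"
        by (simp add: scale_left_diff_distrib algebra_simps)
      then have "l - scale k b \<in> span B"
        using closed_sequentially[OF insert.IH, of "\<lambda>n. X n - scale (c n) b"] c by blast
      then show "l \<in> span (insert b B)" using span_breakdown_eq by blast
    qed
  qed
qed simp

lemma dim_image_inj:
  assumes f: "Vector_Spaces.linear scale scale f" and W: "subspace W" and inj: "inj_on f W"
  shows "dim (f ` W) = dim W"
proof -
  obtain B where B: "B \<subseteq> W" "independent B" "W \<subseteq> span B" "card B = dim W"
    using basis_exists by blast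
  have sp: "span B = W" using B W by (simp add: span_subspace)
  show ?thesis
  proof (rule dim_unique[of "f ` B"])
    show "independent (f ` B)"
      using endo.linear_independent_injective_image[OF f B(2)] inj sp by simp
    show "f ` W \<subseteq> span (f ` B)"
      using endo.linear_span_image[OF f, of B] sp by simp
    show "card (f ` B) = dim W"
      using B inj by (metis card_image inj_on_subset)
  qed (use B in auto)
qed

lemma finite_dim_subspace:
  assumes "subspace S" "S \<subseteq> span B" "finite B"
  obtains C where "finite C" "independent C" "C \<subseteq> S" "span C = S" "card C = dim S"
proof -
  obtain C where C: "C \<subseteq> S" "independent C" "S \<subseteq> span C" "card C = dim S"
    using basis_exists by blast
  then have "finite C"
    using independent_span_bound[OF assms(3) C(2)] assms(2) by auto
  then show ?thesis using C that assms(1) by (metis span_subspace)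
qed

text \<open>The projection onto \<open>W'\<close> along \<open>S\<close> restricts to an isomorphism
  from \<open>W\<close> to \<open>W'\<close>. This frees \<open>codim\<close> from its choice of a
  complement.\<close>

lemma dim_complement_eq:
  assumes S: "subspace S" and W: "complementary S W" and W': "complementary S W'"
  shows "dim W' = dim W"
proof -
  have "\<exists>w\<in>W'. v - w \<in> S" for v
    using W' unfolding complementary_def by (metis add_diff_cancel_right')
  then obtain p where p: "\<And>v. p v \<in> W'" "\<And>v. v - p v \<in> S" by metis
  have uniq: "w = p v" if "w \<in> W'" "v - w \<in> S" for v w
  proof -
    have "w - p v \<in> W'"
      using that p W' subspace_diff unfolding complementary_def by blast
    moreover have "(v - p v) - (v - w) \<in> S"
      using that p S subspace_diff by blast
    ultimately have "w - p v \<in> S \<inter> W'" by simp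
    then show ?thesis using W' unfolding complementary_def by auto
  qed
  have lin: "Vector_Spaces.linear scale scale p"
  proof (rule linear_scaleI)
    show "p (u + v) = p u + p v" for u v
    proof (rule uniq[symmetric])
      show "p u + p v \<in> W'" using p W' subspace_add unfolding complementary_def by blast
      have "(u - p u) + (v - p v) \<in> S" using p S subspace_add by blast
      then show "u + v - (p u + p v) \<in> S" by (simp add: algebra_simps)
    qed
    show "p (scale c v) = scale c (p v)" for c v
    proof (rule uniq[symmetric])
      show "scale c (p v) \<in> W'" using p W' subspace_scale unfolding complementary_def by blast
      have "scale c (v - p v) \<in> S" using p S subspace_scale by blast
      then show "scale c v - scale c (p v) \<in> S" by (simp add: scale_right_diff_distrib)
    qed
  qed
  have sW: "subspace W" using W by (simp add: complementary_def)
  have "inj_on p W"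
  proof (rule inj_onI)
    fix u v assume uv: "u \<in> W" "v \<in> W" "p u = p v"
    have "(u - p u) - (v - p v) \<in> S" using p S subspace_diff by blast
    moreover have "u - v \<in> W" using uv sW subspace_diff by blast
    ultimately have "u - v \<in> S \<inter> W" using uv by simp
    then have "u - v = 0" using W unfolding complementary_def by blast
    then show "u = v" by simp
  qed
  moreover have "p ` W = W'"
  proof
    show "W' \<subseteq> p ` W"
    proof
      fix w' assume w': "w' \<in> W'"
      obtain s w where sw: "s \<in> S" "w \<in> W" "w' = s + w"
        using W unfolding complementary_def by blast
      have "w - w' = - s" using sw by simp
      then have "w' = p w" using sw w' uniq[of w' w] subspace_neg[OF S] by metis
      then show "w' \<in> p ` W" using sw by blast
    qed
  qed (use p in auto)
  ultimately show ?thesis using dim_image_inj[OF lin sW] by simp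
qed

lemma codim_eq_dim_complement:
  assumes "subspace S" "complementary S W"
  shows "codim S = dim W"
  unfolding codim_def using someI[of "complementary S" W] dim_complement_eq assms by blast

text \<open>A common element has the same representation over \<open>C\<close> as over
  \<open>K\<close> and as over \<open>C - K\<close>, so no coefficient can be nonzero.\<close>

lemma span_Int_span_Diff:
  assumes C: "independent C" and "K \<subseteq> C"
  shows "span K \<inter> span (C - K) = {0}"
proof -
  have "x = 0" if x: "x \<in> span K" "x \<in> span (C - K)" for x
  proof -
    have "representation C x = representation K x" "representation C x = representation (C - K) x"
      using representation_extend[OF C x(1)] representation_extend[OF C x(2)] assms(2) by auto
    then have "representation C x b = 0" for b
      using representation_ne_zero[of K x b] representation_ne_zero[of "C - K" x b] by auto
    moreover have "x \<in> span C" using x(1) span_mono[OF assms(2)] by blast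
    ultimately show "x = 0" using sum_nonzero_representation_eq[OF C, of x] by simp
  qed
  then show ?thesis using span_zero by blast
qed

text \<open>The space \<open>V = span B\<close> is invariant under \<open>A\<close>, contains the
  kernel, and \<open>A\<close> is the identity modulo \<open>V\<close>. Kernel and cokernel of
  \<open>A\<close> are thus those of \<open>A\<close> on \<open>V\<close>, where they have equal
  dimension.\<close>

lemma fredholm_id_plus_finite_rank:
  assumes F: "bounded_linear F" and hom: "\<And>c v. F (scale c v) = scale c (F v)"
    and B: "finite B" "\<And>v. F v \<in> span B"
  defines "A \<equiv> \<lambda>v. v + F v"
  shows "fredholm A" and "codim (range A) = dim (kernel A)"
proof -
  have add: "F (u + v) = F u + F v" for u v using F by (simp add: linear_simps)
  have lin: "Vector_Spaces.linear scale scale A"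
    by (rule linear_scaleI) (simp_all add: A_def add hom scale_right_distrib)
  have bl: "bounded_linear A"
    unfolding A_def by (intro bounded_linear_add bounded_linear_ident F)
  define V where "V = span B"
  have sV: "subspace V" and FV: "F v \<in> V" for v using B by (simp_all add: V_def)
  have AV: "A v \<in> V" if "v \<in> V" for v using that FV sV by (simp add: A_def subspace_add)
  have AV': "v \<in> V" if "A v \<in> V" for v
    using subspace_diff[OF sV that FV[of v]] by (simp add: A_def)
  have sK: "subspace (kernel A)"
    unfolding kernel_def by (rule endo.linear_subspace_kernel[OF lin])
  have sR: "subspace (range A)"
    using endo.linear_subspace_image[OF lin subspace_UNIV] .
  have KV: "kernel A \<subseteq> V" using AV' subspace_0[OF sV] by (auto simp: kernel_def)
  obtain K where K: "finite K" "independent K" "K \<subseteq> kernel A" "span K = kernel A"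
      "card K = dim (kernel A)"
    using finite_dim_subspace[OF sK _ B(1)] KV V_def by metis
  \<comment> \<open>Rank-nullity on \<open>V\<close>: the kernel basis \<open>K\<close> is extended
    to a basis \<open>C\<close> of \<open>V\<close>, the added vectors \<open>D\<close> have
    independent images, and these images are extended to a second basis \<open>E\<close> of
    \<open>V\<close>. The vectors of \<open>E\<close> outside the image of \<open>D\<close> span the
    complement \<open>W\<close>.\<close>
  obtain C where C: "K \<subseteq> C" "C \<subseteq> V" "independent C" "V \<subseteq> span C"
    using maximal_independent_subset_extend[of K V] K KV by blast
  have finC: "finite C" using independent_span_bound[OF B(1) C(3)] C(2) V_def by simp
  have spC: "span C = V" using C sV by (simp add: span_subspace)
  define D where "D = C - K"
  have CKD: "C = K \<union> D" "K \<inter> D = {}" using C D_def by auto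
  have injD: "inj_on A (span D)"
  proof (rule inj_onI)
    fix u v assume uv: "u \<in> span D" "v \<in> span D" "A u = A v"
    then have "u - v \<in> span K"
      using K lin by (simp add: kernel_def endo.linear_diff)
    moreover have "u - v \<in> span D" using uv span_diff by blast
    ultimately have "u - v \<in> span K \<inter> span D" by blast
    moreover have "span K \<inter> span D = {0}"
      using span_Int_span_Diff[OF C(3,1)] D_def by simp
    ultimately show "u = v" by simp
  qed
  have AK: "A ` K \<subseteq> {0}" using K(3) by (auto simp: kernel_def)
  have "A ` V = span (A ` C)" using endo.linear_span_image[OF lin] spC by metis
  also have "\<dots> = span (A ` D)"
  proof (rule span_eq[THEN iffD2], intro conjI)
    show "A ` C \<subseteq> span (A ` D)"
    proof
      fix x assume "x \<in> A ` C"
      then have "x = 0 \<or> x \<in> A ` D" using AK unfolding D_def by auto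
      then show "x \<in> span (A ` D)" using span_base[of x "A ` D"] span_zero by auto
    qed
    show "A ` D \<subseteq> span (A ` C)" unfolding D_def by (auto intro: span_base)
  qed
  finally have imV: "A ` V = span (A ` D)" .
  have ind: "independent (A ` D)"
  proof (rule endo.linear_independent_injective_image[OF lin _ injD])
    show "independent D" using independent_mono[OF C(3)] unfolding D_def by blast
  qed
  have "A ` D \<subseteq> V" using C(2) AV CKD by blast
  then obtain E where E: "A ` D \<subseteq> E" "E \<subseteq> V" "independent E" "V \<subseteq> span E"
    using maximal_independent_subset_extend[OF _ ind] by metis
  have finE: "finite E" using independent_span_bound[OF B(1) E(3)] E(2) V_def by simp
  define W where "W = span (E - A ` D)"
  have WV: "W \<subseteq> V" unfolding W_def using E(2) sV by (intro span_minimal) auto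
  have compl: "complementary (range A) W"
    unfolding complementary_def
  proof (intro conjI allI)
    show "subspace W" by (simp add: W_def)
    have "range A \<inter> W \<subseteq> A ` V \<inter> W" using AV' WV by blast
    then have "range A \<inter> W \<subseteq> {0}"
      using span_Int_span_Diff[OF E(3,1)] unfolding imV W_def by simp
    then show "range A \<inter> W = {0}"
      using subspace_0[OF sR] span_zero[of "E - A ` D"] unfolding W_def by blast
    fix v
    \<comment> \<open>Since \<open>v = A v - F v\<close>, only \<open>F v\<close>, which lies in
      \<open>V\<close>, has to be split between the image of \<open>V\<close> and
      \<open>W\<close>.\<close>
    have "F v \<in> span (A ` D \<union> (E - A ` D))" using FV E by (auto simp: Un_absorb1)
    then obtain x y where xy: "F v = x + y" "x \<in> A ` V" "y \<in> W"
      unfolding span_Un imV W_def by blast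
    have "v = (A v - x) + - y" using xy(1) by (simp add: A_def)
    moreover have "A v - x \<in> range A" using xy(2) subspace_diff[OF sR] by blast
    moreover have "- y \<in> W" using xy(3) by (simp add: W_def span_neg)
    ultimately show "\<exists>s\<in>range A. \<exists>w\<in>W. v = s + w" by blast
  qed
  have "dim W = card (E - A ` D)"
    unfolding W_def using E(3) independent_mono by (intro dim_span_eq_card_independent) blast
  also have "\<dots> = card E - card (A ` D)"
    using E(1) finE finite_subset by (intro card_Diff_subset) auto
  also have "card E = card C"
    using basis_card_eq_dim[OF C(2,4,3)] basis_card_eq_dim[OF E(2,4,3)] by simp
  also have "card (A ` D) = card D"
    using injD by (intro card_image) (meson inj_on_subset span_superset)
  also have "card C - card D = card K"
    using finC CKD by (simp add: card_Un_disjoint)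
  finally have dW: "dim W = dim (kernel A)" using K by simp
  then show "codim (range A) = dim (kernel A)" using codim_eq_dim_complement[OF sR compl] by simp
  \<comment> \<open>Closedness of the range is reduced to finite dimension: the range is the
    preimage, under a continuous map, of a finite span. If \<open>F y = A v\<close>, then
    \<open>y - v\<close> is a preimage of \<open>y\<close> under \<open>A\<close>.\<close>
  have "range A = F -` (A ` V)"
  proof (intro equalityI subsetI)
    fix y assume "y \<in> range A"
    then obtain v where "y = A v" by blast
    then have "F y = A (F v)" by (simp add: A_def add)
    then show "y \<in> F -` (A ` V)" using FV by blast
  next
    fix y assume "y \<in> F -` (A ` V)"
    then obtain v where v: "F y = A v" by blast
    have "F (y - v) = v"
      using v(1) bounded_linear.linear[OF F, THEN linear_diff, of y v] by (simp add: A_def)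
    then have "y = A (y - v)" by (simp add: A_def)
    then show "y \<in> range A" by blast
  qed
  moreover have "closed (A ` V)"
    unfolding imV using finE E(1) by (intro closed_span_finite) (rule finite_subset)
  ultimately have "closed (range A)"
    using closed_vimage linear_continuous_on[OF F] by (metis continuous_on_eq_continuous_at)
  moreover have "finite_codim (range A)"
    unfolding finite_codim_def finite_dim_def using compl finE W_def by blast
  moreover have "finite_dim (kernel A)" unfolding finite_dim_def using K by blast
  moreover have "A (scale c v) = scale c (A v)" for c v
    using lin by (rule endo.linear_scale)
  ultimately show "fredholm A" unfolding fredholm_def using bl by blast
qed

text \<open>With \<open>R\<close> the inverse of \<open>S\<close>, the operator factors as
  \<open>S + F = (id + F R) S\<close>: it has the range of \<open>id + F R\<close>, and its kernel
  is carried over by \<open>R\<close>. The bound \<open>low\<close> gives injectivity of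
  \<open>S\<close> and makes \<open>R\<close> bounded.\<close>

lemma fredholm_bijective_plus_finite_rank:
  assumes S: "bounded_linear S" and homS: "\<And>c v. S (scale c v) = scale c (S v)"
    and surj: "surj S" and low: "\<And>v. norm v \<le> C * norm (S v)"
    and F: "bounded_linear F" and homF: "\<And>c v. F (scale c v) = scale c (F v)"
    and B: "finite B" "\<And>v. F v \<in> span B"
  shows "fredholm (\<lambda>v. S v + F v)" and "fredholm_index (\<lambda>v. S v + F v) = 0"
proof -
  have "inj S"
  proof (rule injI)
    fix u v assume "S u = S v"
    then have "S (u - v) = 0" using S by (simp add: linear_simps)
    then show "u = v" using low[of "u - v"] by simp
  qed
  define R where "R = inv S"
  have SR: "S (R v) = v" and RS: "R (S v) = v" for v
    using surj \<open>inj S\<close> by (simp_all add: R_def surj_f_inv_f)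
  have Radd: "R (u + v) = R u + R v" for u v
    using linear_simps(1)[OF S, of "R u" "R v"] RS[of "R u + R v"] by (simp add: SR)
  have homR: "R (scale c v) = scale c (R v)" for c v
    using homS SR RS by metis
  have linR: "Vector_Spaces.linear scale scale R"
    by (rule linear_scaleI) (simp_all add: Radd homR)
  have R: "bounded_linear R"
  proof (rule bounded_linear_intro[where K = C])
    show "R (r *\<^sub>R v) = r *\<^sub>R R v" for r v using homR by (metis scale_of_real)
    show "norm (R v) \<le> norm v * C" for v using low[of "R v"] by (simp add: SR mult.commute)
  qed (rule Radd)
  define A where "A v = v + F (R v)" for v
  have FR: "bounded_linear (\<lambda>v. F (R v))" using bounded_linear_compose[OF F R] .
  have hFR: "F (R (scale c v)) = scale c (F (R v))" for c v by (simp add: homF homR)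
  have A: "fredholm A" "codim (range A) = dim (kernel A)"
    using fredholm_id_plus_finite_rank[OF FR hFR B] unfolding A_def by auto
  have L: "(\<lambda>v. S v + F v) = A \<circ> S" by (auto simp: A_def RS)
  have ran: "range (\<lambda>v. S v + F v) = range A"
    unfolding L image_comp[symmetric] using surj by simp
  have ker: "kernel (\<lambda>v. S v + F v) = R ` kernel A"
  proof safe
    fix v assume "v \<in> kernel (\<lambda>v. S v + F v)"
    then have "S v \<in> kernel A" by (simp add: kernel_def A_def RS)
    then show "v \<in> R ` kernel A" using RS[of v] by (metis imageI)
  next
    fix w assume "w \<in> kernel A"
    then show "R w \<in> kernel (\<lambda>v. S v + F v)" by (simp add: kernel_def A_def SR)
  qed
  have sK: "subspace (kernel A)"
  proof -
    have "Vector_Spaces.linear scale scale A"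
      using A(1) unfolding fredholm_def by (intro linear_scaleI) (simp_all add: linear_simps)
    then show ?thesis unfolding kernel_def by (rule endo.linear_subspace_kernel)
  qed
  have "dim (R ` kernel A) = dim (kernel A)"
    using dim_image_inj[OF linR sK] SR by (metis inj_on_def)
  then show "fredholm_index (\<lambda>v. S v + F v) = 0"
    unfolding fredholm_index_def ran ker using A(2) by simp
  obtain K where "finite K" "span K = kernel A"
    using A(1) unfolding fredholm_def finite_dim_def by blast
  then have "finite_dim (R ` kernel A)"
    unfolding finite_dim_def using endo.linear_span_image[OF linR] by (metis finite_imageI)
  then show "fredholm (\<lambda>v. S v + F v)"
    using A(1) unfolding fredholm_def ran ker
    by (auto intro!: bounded_linear_add S F simp: homS homF scale_right_distrib)
qed

end

section \<open>Linear differential equations with bounded coefficients\<close>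

text \<open>The right-hand side is the integral of \<open>c * S * exp (2 * c * s)\<close> from 0 to
  \<open>t\<close>. The rate is twice the constant \<open>c\<close>, so integration produces a
  factor 1/2: it lets the estimate in \<open>gronwall_bound\<close> be absorbed and is the
  contraction constant in \<open>solution_exists\<close>.\<close>

lemma exp_growth_bound_nonneg:
  fixes V :: "real \<Rightarrow> 'a::real_normed_vector"
  assumes "t \<ge> 0"
    and V: "\<And>s. \<lbrakk>0 \<le> s; s \<le> t\<rbrakk> \<Longrightarrow> (V has_vector_derivative D s) (at s)"
    and D: "\<And>s. \<lbrakk>0 \<le> s; s \<le> t\<rbrakk> \<Longrightarrow> norm (D s) \<le> c * S * exp (2 * c * s)"
  shows "norm (V t - V 0) \<le> S / 2 * (exp (2 * c * t) - 1)"
proof (cases "t = 0")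
  case False
  have "norm (V t - V 0) \<le> S / 2 * exp (2 * c * t) - S / 2 * exp (2 * c * 0)"
  proof (rule differentiable_bound_general)
    show "0 < t" using False assms(1) by simp
    show "continuous_on {0..t} V"
      using V by (intro continuous_at_imp_continuous_on ballI)
        (auto intro: has_vector_derivative_continuous)
    show "continuous_on {0..t} (\<lambda>s. S / 2 * exp (2 * c * s))" by (intro continuous_intros)
    show "((\<lambda>s. S / 2 * exp (2 * c * s)) has_vector_derivative c * S * exp (2 * c * s)) (at s)"
      for s
      unfolding has_real_derivative_iff_has_vector_derivative[symmetric]
      by (auto intro!: derivative_eq_intros)
    show "(V has_vector_derivative D s) (at s)" "norm (D s) \<le> c * S * exp (2 * c * s)"
      if "0 < s" "s < t" for s
      using that V D by auto
  qed
  then show ?thesis by (simp add: algebra_simps)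
qed simp

lemma exp_growth_bound:
  fixes V :: "real \<Rightarrow> 'a::real_normed_vector"
  assumes V: "\<And>s. \<bar>s\<bar> \<le> \<bar>t\<bar> \<Longrightarrow> (V has_vector_derivative D s) (at s)"
    and D: "\<And>s. \<bar>s\<bar> \<le> \<bar>t\<bar> \<Longrightarrow> norm (D s) \<le> c * S * exp (2 * c * \<bar>s\<bar>)"
  shows "norm (V t - V 0) \<le> S / 2 * (exp (2 * c * \<bar>t\<bar>) - 1)"
proof (cases "t \<ge> 0")
  case True
  have "norm (V t - V 0) \<le> S / 2 * (exp (2 * c * t) - 1)"
  proof (rule exp_growth_bound_nonneg[OF True])
    fix s assume "0 \<le> s" "s \<le> t"
    then show "(V has_vector_derivative D s) (at s)" "norm (D s) \<le> c * S * exp (2 * c * s)"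
      using V[of s] D[of s] by auto
  qed
  then show ?thesis using True by simp
next
  case False
  have "norm (V (- (- t)) - V (- 0)) \<le> S / 2 * (exp (2 * c * (- t)) - 1)"
  proof (rule exp_growth_bound_nonneg)
    fix s assume s: "0 \<le> s" "s \<le> - t"
    have "((V \<circ> uminus) has_vector_derivative (-1) *\<^sub>R D (- s)) (at s)"
      using s False by (intro vector_diff_chain_at V) (auto intro!: derivative_eq_intros)
    then show "((\<lambda>s. V (- s)) has_vector_derivative - D (- s)) (at s)"
      by (simp add: comp_def)
    show "norm (- D (- s)) \<le> c * S * exp (2 * c * s)"
      using D[of "- s"] s False by simp
  qed (use False in simp)
  then show ?thesis using False by simp
qed

text \<open>Let \<open>S\<close> be the maximum of
  \<open>norm (V s) * exp (- (2 * c * \<bar>s\<bar>))\<close> on the compact interval, attained at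
  \<open>r\<close>. The growth bound at \<open>r\<close> controls \<open>norm (V r - V 0)\<close> by
  half of \<open>S * exp (2 * c * \<bar>r\<bar>) = norm (V r)\<close>; absorbing that half gives
  \<open>S \<le> 2 * norm (V 0)\<close>.\<close>

lemma gronwall_bound:
  fixes V :: "real \<Rightarrow> 'a::real_normed_vector"
  assumes c: "c \<ge> 0"
    and V: "\<And>s. (V has_vector_derivative D s) (at s)"
    and D: "\<And>s. norm (D s) \<le> c * norm (V s)"
  shows "norm (V t) \<le> 2 * norm (V 0) * exp (2 * c * \<bar>t\<bar>)"
proof -
  let ?h = "\<lambda>s. norm (V s) * exp (- (2 * c * \<bar>s\<bar>))"
  have contV: "continuous_on {-\<bar>t\<bar>..\<bar>t\<bar>} V"
    using V by (intro continuous_at_imp_continuous_on ballI) (auto intro: has_vector_derivative_continuous)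
  have "\<exists>r\<in>{-\<bar>t\<bar>..\<bar>t\<bar>}. \<forall>s\<in>{-\<bar>t\<bar>..\<bar>t\<bar>}. ?h s \<le> ?h r"
    by (intro continuous_attains_sup continuous_intros contV) auto
  then obtain r where r: "\<bar>r\<bar> \<le> \<bar>t\<bar>" and max: "\<And>s. \<bar>s\<bar> \<le> \<bar>t\<bar> \<Longrightarrow> ?h s \<le> ?h r"
    by (auto simp: abs_le_iff minus_le_iff)
  define S where "S = ?h r"
  have le: "norm (V s) \<le> S * exp (2 * c * \<bar>s\<bar>)" if "\<bar>s\<bar> \<le> \<bar>t\<bar>" for s
    using max[OF that] by (simp add: S_def exp_minus divide_simps)
  have "norm (V r - V 0) \<le> S / 2 * (exp (2 * c * \<bar>r\<bar>) - 1)"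
  proof (rule exp_growth_bound)
    fix s assume "\<bar>s\<bar> \<le> \<bar>r\<bar>"
    then show "norm (D s) \<le> c * S * exp (2 * c * \<bar>s\<bar>)"
      using D[of s] mult_left_mono[OF le[of s] c] r by (simp add: mult.assoc)
  qed (rule V)
  moreover have "norm (V r) = S * exp (2 * c * \<bar>r\<bar>)"
    by (simp add: S_def flip: exp_add mult.assoc)
  moreover have "norm (V r) \<le> norm (V r - V 0) + norm (V 0)"
    using norm_triangle_ineq[of "V r - V 0" "V 0"] by simp
  moreover have S: "S \<ge> 0" by (simp add: S_def)
  ultimately have "S / 2 * exp (2 * c * \<bar>r\<bar>) \<le> norm (V 0)"
    by (simp add: algebra_simps)
  moreover have "S / 2 * 1 \<le> S / 2 * exp (2 * c * \<bar>r\<bar>)"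
    using c S by (intro mult_left_mono) auto
  ultimately have "S \<le> 2 * norm (V 0)" by simp
  then have "S * exp (2 * c * \<bar>t\<bar>) \<le> 2 * norm (V 0) * exp (2 * c * \<bar>t\<bar>)"
    by (intro mult_right_mono) auto
  with le[of t] show ?thesis by linarith
qed

lemma antiderivative_exists:
  fixes f :: "real \<Rightarrow> 'a::banach"
  assumes f: "continuous_on UNIV f"
  shows "\<exists>F. F 0 = 0 \<and> (\<forall>t. (F has_vector_derivative f t) (at t))"
proof -
  \<comment> \<open>The oriented integral from 0 to \<open>t\<close>: for either sign of
    \<open>t\<close> one of the two integrals vanishes.\<close>
  let ?F = "\<lambda>t. integral {0..t} f - integral {t..0} f"
  have "(?F has_vector_derivative f t) (at t)" for t
  proof -
    define R where "R = \<bar>t\<bar> + 1"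
    have int: "f integrable_on {a..b}" for a b
      using continuous_on_subset[OF f] by (intro integrable_continuous_interval) auto
    \<comment> \<open>Near \<open>t\<close> the oriented integral differs by a constant from the
      integral starting at \<open>-R\<close>, which handles both signs, and 0 itself, at
      once.\<close>
    have eq: "integral {-R..s} f - integral {-R..0} f = ?F s" if "s \<in> {-R<..<R}" for s
    proof (cases "s \<ge> 0")
      case True
      then have "integral {-R..0} f + integral {0..s} f = integral {-R..s} f"
        using int by (intro Henstock_Kurzweil_Integration.integral_combine) (auto simp: R_def)
      moreover have "integral {s..0} f = 0" using True by (cases "s = 0") auto
      ultimately show ?thesis by (simp add: algebra_simps)
    next
      case False
      then have "integral {-R..s} f + integral {s..0} f = integral {-R..0} f"
        using int that by (intro Henstock_Kurzweil_Integration.integral_combine) auto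
      then show ?thesis using False by (simp add: algebra_simps)
    qed
    have "((\<lambda>s. integral {-R..s} f) has_vector_derivative f t) (at t within {-R..R})"
      using continuous_on_subset[OF f] by (intro integral_has_vector_derivative) (auto simp: R_def)
    moreover have "at t within {-R..R} = at t"
      by (rule at_within_interior) (auto simp: R_def)
    ultimately have "((\<lambda>s. integral {-R..s} f - integral {-R..0} f) has_vector_derivative f t - 0) (at t)"
      by (intro has_vector_derivative_diff) auto
    then have "((\<lambda>s. integral {-R..s} f - integral {-R..0} f) has_vector_derivative f t) (at t)"
      by simp
    then show ?thesis
      by (rule has_vector_derivative_transform_within_open[where S = "{-R<..<R}"])
        (use eq in \<open>auto simp: R_def\<close>)
  qed
  then show ?thesis by (intro exI[of _ ?F]) simp
qed

text \<open>The assumption \<open>cont\<close> is stated along continuous curves because this is the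
  form that the integral equation uses: the right-hand side must have an antiderivative.\<close>

locale bounded_linear_ode =
  fixes L :: "real \<Rightarrow> 'a::banach \<Rightarrow> 'a" and c :: real
  assumes c_nonneg: "c \<ge> 0"
    and linear: "\<And>t. linear (L t)"
    and bound: "\<And>t v. norm (L t v) \<le> c * norm v"
    and cont: "\<And>V. continuous_on UNIV V \<Longrightarrow> continuous_on UNIV (\<lambda>t. L t (V t))"
begin

lemma diff: "L t (u - v) = L t u - L t v"
  by (rule linear_diff[OF linear])

lemma solution_bound:
  assumes "solves_linear_ode L v V"
  shows "norm (V t) \<le> 2 * norm v * exp (2 * c * \<bar>t\<bar>)"
proof -
  have "V 0 = v" and "\<And>s. (V has_vector_derivative L s (V s)) (at s)"
    using assms by (auto simp: solves_linear_ode_def)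
  then show ?thesis using gronwall_bound[of c V "\<lambda>s. L s (V s)" t] c_nonneg bound by simp
qed

lemma solution_unique:
  assumes V: "solves_linear_ode L v V" and W: "solves_linear_ode L v W"
  shows "V = W"
proof
  fix t
  have "solves_linear_ode L 0 (\<lambda>t. V t - W t)"
    using V W unfolding solves_linear_ode_def
    by (auto simp: diff intro!: has_vector_derivative_diff)
  from solution_bound[OF this, of t] show "V t = W t" by simp
qed

text \<open>Existence by the contraction principle for \<open>exp (- 2 c \<bar>t\<bar>) V(t)\<close> in the space of
  bounded continuous functions; the weight makes the integral operator a contraction on the
  whole line.\<close>

lemma solution_exists: "\<exists>V. solves_linear_ode L v V"
proof -
  obtain J :: "(real \<Rightarrow> 'a) \<Rightarrow> real \<Rightarrow> 'a"
    where J0: "\<And>f. continuous_on UNIV f \<Longrightarrow> J f 0 = 0"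
    and J: "\<And>f t. continuous_on UNIV f \<Longrightarrow> (J f has_vector_derivative f t) (at t)"
    using antiderivative_exists by metis
  define w where "w t = exp (2 * c * \<bar>t\<bar>)" for t :: real
  have w: "w t > 0" "w t \<ge> 1" "inverse (w t) \<le> 1" for t
    using c_nonneg by (auto simp: w_def inverse_le_1_iff)
  have contw: "continuous_on UNIV w" unfolding w_def by (intro continuous_intros)
  define g where "g U s = L s (w s *\<^sub>R apply_bcontfun U s)" for U s
  have contg: "continuous_on UNIV (g U)" for U
    unfolding g_def by (intro cont continuous_intros contw) auto
  define P where "P U t = inverse (w t) *\<^sub>R (v + J (g U) t)" for U t
  have contJ: "continuous_on UNIV (J (g U))" for U
    using J[OF contg] by (intro continuous_at_imp_continuous_on ballI)
        (auto intro: has_vector_derivative_continuous)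
  have P_bound: "norm (P U t) \<le> norm v + norm U / 2" for U t
  proof -
    have "norm (J (g U) t - J (g U) 0) \<le> norm U / 2 * (exp (2 * c * \<bar>t\<bar>) - 1)"
    proof (rule exp_growth_bound)
      fix s
      have "norm (g U s) \<le> c * (w s * norm (apply_bcontfun U s))"
        using bound[of s "w s *\<^sub>R apply_bcontfun U s"] w(1)[of s] by (simp add: g_def)
      also have "\<dots> \<le> c * (w s * norm U)"
        using c_nonneg w(1)[of s] norm_bounded[of U s] by (intro mult_left_mono) auto
      finally show "norm (g U s) \<le> c * norm U * exp (2 * c * \<bar>s\<bar>)" by (simp add: w_def ac_simps)
    qed (rule J[OF contg])
    then have "norm (J (g U) t) \<le> norm U / 2 * w t"
      by (simp add: J0[OF contg] w_def algebra_simps) (smt (verit) norm_ge_zero)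
    then have "norm (P U t) \<le> inverse (w t) * (norm v + norm U / 2 * w t)"
      unfolding P_def using w(1)[of t] norm_triangle_ineq[of v "J (g U) t"]
      by (simp add: divide_simps)
    also have "\<dots> = inverse (w t) * norm v + norm U / 2"
      using w(1)[of t] by (simp add: field_simps)
    also have "\<dots> \<le> norm v + norm U / 2"
      using w(3)[of t] mult_right_mono[of "inverse (w t)" 1 "norm v"] by simp
    finally show ?thesis .
  qed
  have "continuous_on UNIV (P U)" for U
    unfolding P_def using w(1) by (intro continuous_intros contw contJ) (simp add: less_imp_neq[symmetric])
  then have PB: "apply_bcontfun (Bcontfun (P U)) = P U" for U
    using P_bound by (intro Bcontfun_inverse bcontfun_normI) auto
  have "dist (Bcontfun (P U)) (Bcontfun (P U')) \<le> 1 / 2 * dist U U'" for U U'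
  proof (rule dist_bound)
    fix t
    have "norm ((J (g U) t - J (g U') t) - (J (g U) 0 - J (g U') 0))
        \<le> dist U U' / 2 * (exp (2 * c * \<bar>t\<bar>) - 1)"
    proof (rule exp_growth_bound)
      fix s
      show "((\<lambda>t. J (g U) t - J (g U') t) has_vector_derivative g U s - g U' s) (at s)"
        by (intro has_vector_derivative_diff J contg)
      have "g U s - g U' s = L s (w s *\<^sub>R (apply_bcontfun U s - apply_bcontfun U' s))"
        by (simp add: g_def diff scaleR_diff_right)
      then have "norm (g U s - g U' s) \<le> c * (w s * dist (apply_bcontfun U s) (apply_bcontfun U' s))"
        using bound[of s "w s *\<^sub>R (apply_bcontfun U s - apply_bcontfun U' s)"] w(1)[of s]
        by (simp add: dist_norm)
      also have "\<dots> \<le> c * (w s * dist U U')"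
        using c_nonneg w(1)[of s] dist_bounded[of U s U'] by (intro mult_left_mono) auto
      finally show "norm (g U s - g U' s) \<le> c * dist U U' * exp (2 * c * \<bar>s\<bar>)"
        by (simp add: w_def ac_simps)
    qed
    then have "norm (J (g U) t - J (g U') t) \<le> dist U U' / 2 * w t"
      by (simp add: J0[OF contg] w_def algebra_simps) (smt (verit) zero_le_dist)
    moreover have "P U t - P U' t = inverse (w t) *\<^sub>R (J (g U) t - J (g U') t)"
      by (simp add: P_def algebra_simps)
    ultimately show "dist (apply_bcontfun (Bcontfun (P U)) t) (apply_bcontfun (Bcontfun (P U')) t)
        \<le> 1 / 2 * dist U U'"
      using w(1)[of t] by (simp add: PB dist_norm divide_simps)
  qed
  then have "\<exists>!U. Bcontfun (P U) = U"
    by (intro banach_fix_type[of "1 / 2"]) auto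
  then obtain U where "Bcontfun (P U) = U" by blast
  then have U: "apply_bcontfun U t = P U t" for t using PB[of U] by simp
  define V where "V t = w t *\<^sub>R apply_bcontfun U t" for t
  have V: "V t = v + J (g U) t" for t
    using w(1)[of t] by (simp add: V_def U P_def)
  have gV: "g U = (\<lambda>s. L s (V s))" by (simp add: g_def[abs_def] V_def)
  have "((\<lambda>t. v + J (g U) t) has_vector_derivative 0 + g U t) (at t)" for t
    by (intro has_vector_derivative_add J contg) auto
  then have "(V has_vector_derivative g U t) (at t)" for t unfolding V[abs_def] by simp
  moreover have "V 0 = v" unfolding V by (simp add: J0[OF contg])
  ultimately have "solves_linear_ode L v V"
    unfolding solves_linear_ode_def gV by simp
  then show ?thesis by blast
qed

lemma evolution_operator_eq:
  assumes "solves_linear_ode L v V"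
  shows "evolution_operator L t v = V t"
proof -
  have "(THE V. solves_linear_ode L v V) = V"
    using assms solution_unique by (intro the_equality)
  then show ?thesis by (simp add: evolution_operator_def)
qed

lemma solves_evolution_operator: "solves_linear_ode L v (\<lambda>t. evolution_operator L t v)"
proof -
  obtain V where V: "solves_linear_ode L v V" using solution_exists by blast
  then have "(\<lambda>t. evolution_operator L t v) = V" using evolution_operator_eq by blast
  then show ?thesis using V by simp
qed

end

section \<open>Multiplication operators with equicontinuous perturbations\<close>

lemma bounded_linear_apply_cper: "bounded_linear (\<lambda>f. apply_cper f x)"
  by (rule bounded_linear_intro[where K = 1])
    (simp_all add: plus_cper.rep_eq scaleR_cper.rep_eq norm_apply_cper_le)

lemma apply_cper_sum: "apply_cper (sum f I) x = (\<Sum>i\<in>I. apply_cper (f i) x)"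
  using linear_sum[OF bounded_linear.linear[OF bounded_linear_apply_cper]] .

text \<open>The sup norm makes \<open>h t\<close> close to \<open>h t0\<close> at all points
  simultaneously, so continuity of the single function \<open>h t0\<close> finishes the
  estimate.\<close>

lemma continuous_on_apply_cper:
  assumes h: "continuous_on UNIV h"
  shows "continuous_on UNIV (\<lambda>(x, t). apply_cper (h t) x)"
  unfolding continuous_on_def
proof (intro ballI)
  fix q :: "real \<times> 'a"
  obtain x0 t0 where q: "q = (x0, t0)" by force
  have hl: "((\<lambda>p. h (snd p)) \<longlongrightarrow> h t0) (at q)"
  proof (rule tendsto_compose[where g = h])
    show "(h \<longlongrightarrow> h t0) (at t0)" using h by (simp add: continuous_on_def)
  qed (auto simp: q intro!: tendsto_eq_intros)
  have fl: "((\<lambda>p. apply_cper (h t0) (fst p)) \<longlongrightarrow> apply_cper (h t0) x0) (at q)"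
  proof (rule tendsto_compose[where g = "apply_cper (h t0)"])
    show "(apply_cper (h t0) \<longlongrightarrow> apply_cper (h t0) x0) (at x0)"
      using apply_cper_continuous[of UNIV "h t0"] by (simp add: continuous_on_def)
  qed (auto simp: q intro!: tendsto_eq_intros)
  have "((\<lambda>p. apply_cper (h (snd p)) (fst p) - apply_cper (h t0) (fst p)) \<longlongrightarrow> 0) (at q)"
  proof (rule Lim_null_comparison)
    show "\<forall>\<^sub>F p in at q. norm (apply_cper (h (snd p)) (fst p) - apply_cper (h t0) (fst p))
        \<le> norm (h (snd p) - h t0)"
      by (intro always_eventually allI) (metis minus_cper.rep_eq norm_apply_cper_le)
    show "((\<lambda>p. norm (h (snd p) - h t0)) \<longlongrightarrow> 0) (at q)"
      using tendsto_norm[OF tendsto_diff[OF hl tendsto_const[of "h t0"]]] by simp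
  qed
  from tendsto_add[OF this fl]
  show "((\<lambda>(x, t). apply_cper (h t) x) \<longlongrightarrow> (case q of (x, t) \<Rightarrow> apply_cper (h t) x)) (at q within UNIV)"
    by (simp add: q case_prod_unfold)
qed

text \<open>The converse passage: compactness of one period turns joint continuity into closeness
  uniform in x. All sup norm continuity in time is obtained in this way from pointwise
  formulas.\<close>

lemma continuous_on_cperI:
  assumes h: "continuous_on UNIV (\<lambda>(x, t). apply_cper (h t) x)"
  shows "continuous_on UNIV h"
  unfolding continuous_on_def
proof (intro ballI tendstoI)
  fix t0 and e :: real assume "e > 0"
  then have e: "e / 2 > 0" by simp
  have "continuous_on (UNIV \<times> {-pi..pi}) (\<lambda>(t, x). apply_cper (h t) x)"
    using continuous_on_compose2[OF h continuous_on_swap, of "UNIV \<times> {-pi..pi}"]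
    by (simp add: case_prod_beta)
  then obtain X where X: "t0 \<in> X" "open X"
      "\<forall>t\<in>X \<inter> UNIV. \<forall>x\<in>{-pi..pi}. dist ((\<lambda>(t, x). apply_cper (h t) x) (t, x))
         ((\<lambda>(t, x). apply_cper (h t) x) (t0, x)) \<le> e / 2"
    by (rule continuous_on_prod_compactE[OF _ _ _ e]) auto
  have "dist (h t) (h t0) < e" if "t \<in> X" for t
  proof -
    have "norm (h t - h t0) \<le> e / 2"
    proof (rule norm_cper_le)
      fix x
      obtain y where "y \<in> {-pi..pi}" "apply_cper (h t - h t0) x = apply_cper (h t - h t0) y"
        using periodic_obtain[of "apply_cper (h t - h t0)" x] apply_cper_periodic by blast
      then show "norm (apply_cper (h t - h t0) x) \<le> e / 2"
        using X(3) that by (simp add: minus_cper.rep_eq dist_norm)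
    qed
    then show ?thesis using \<open>e > 0\<close> by (simp add: dist_norm)
  qed
  then show "\<forall>\<^sub>F t in at t0 within UNIV. dist (h t) (h t0) < e"
    using X(1,2) eventually_at_topological by blast
qed

lemma Abs_cper_apply:
  assumes "continuous_on UNIV u" "continuous_on UNIV v"
    and "\<And>x. u (x + 2 * pi) = u x" "\<And>x. v (x + 2 * pi) = v x"
  shows "apply_cper (Abs_cper (\<lambda>x. (u x, v x))) x = (u x, v x)"
  by (subst Abs_cper_inverse) (use assms in \<open>auto intro!: continuous_intros\<close>)

text \<open>Meaningful for continuous \<open>2 * pi\<close>-periodic \<open>m\<close> and
  \<open>n\<close>, where the pair lies in the domain of \<open>Abs_cper\<close>; hence the
  recurring four assumptions below.\<close>

definition mult_cper :: "(real \<Rightarrow> complex) \<Rightarrow> (real \<Rightarrow> complex) \<Rightarrow> cper \<Rightarrow> cper" where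
  "mult_cper m n f = Abs_cper (\<lambda>x. (m x * fst (apply_cper f x), n x * snd (apply_cper f x)))"

lemma apply_mult_cper:
  assumes "continuous_on UNIV m" "continuous_on UNIV n"
    and "\<And>x. m (x + 2 * pi) = m x" "\<And>x. n (x + 2 * pi) = n x"
  shows "apply_cper (mult_cper m n f) x = (m x * fst (apply_cper f x), n x * snd (apply_cper f x))"
  unfolding mult_cper_def using assms
  by (intro Abs_cper_apply) (auto intro!: continuous_intros apply_cper_continuous simp: apply_cper_periodic)

lemma norm_mult_cper_le:
  assumes "continuous_on UNIV m" "continuous_on UNIV n"
    and "\<And>x. m (x + 2 * pi) = m x" "\<And>x. n (x + 2 * pi) = n x"
    and b: "\<And>x. norm (m x) \<le> b" "\<And>x. norm (n x) \<le> b"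
  shows "norm (mult_cper m n f) \<le> b * norm f"
proof (rule norm_cper_le)
  fix x
  have b0: "b \<ge> 0" using b(1)[of 0] norm_ge_zero order_trans by blast
  obtain u v where uv: "apply_cper f x = (u, v)" by force
  have "norm (m x * u, n x * v) \<le> sqrt ((b * norm u)\<^sup>2 + (b * norm v)\<^sup>2)"
    unfolding norm_Pair norm_mult
    by (intro real_sqrt_le_mono add_mono power_mono mult_right_mono b) auto
  also have "\<dots> = b * norm (u, v)"
    using b0 by (simp add: norm_Pair power_mult_distrib real_sqrt_mult flip: distrib_left)
  also have "\<dots> \<le> b * norm f"
    using b0 norm_apply_cper_le[of f x] uv by (intro mult_left_mono) auto
  finally show "norm (apply_cper (mult_cper m n f) x) \<le> b * norm f"
    by (simp add: apply_mult_cper assms(1-4) uv)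
qed

lemma mult_cper_scaleC:
  assumes "continuous_on UNIV m" "continuous_on UNIV n"
    and "\<And>x. m (x + 2 * pi) = m x" "\<And>x. n (x + 2 * pi) = n x"
  shows "mult_cper m n (scaleC_cper c f) = scaleC_cper c (mult_cper m n f)"
  by (rule cper_eqI) (simp add: apply_mult_cper[OF assms] scaleC_cper.rep_eq algebra_simps)

lemma bounded_linear_mult_cper:
  assumes "continuous_on UNIV m" "continuous_on UNIV n"
    and "\<And>x. m (x + 2 * pi) = m x" "\<And>x. n (x + 2 * pi) = n x"
  shows "bounded_linear (mult_cper m n)"
proof -
  \<comment> \<open>The pair \<open>(m, n)\<close> is itself an element of \<open>cper\<close>, and
    as such is bounded.\<close>
  have "bdd_above (range (\<lambda>x. norm (apply_cper (Abs_cper (\<lambda>x. (m x, n x))) x)))"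
    by (rule bdd_above_apply_cper)
  then obtain b where b: "\<And>x. norm (m x, n x) \<le> b"
    using assms by (auto simp: Abs_cper_apply bdd_above_def)
  have "norm (mult_cper m n f) \<le> b * norm f" for f
    by (intro norm_mult_cper_le assms order_trans[OF _ b]) (use norm_fst_le norm_snd_le in auto)
  moreover have "mult_cper m n (r *\<^sub>R f) = r *\<^sub>R mult_cper m n f" for r f
    by (metis mult_cper_scaleC[OF assms] cper.scale_of_real)
  moreover have "mult_cper m n (f + g) = mult_cper m n f + mult_cper m n g" for f g
    by (rule cper_eqI) (simp add: apply_mult_cper[OF assms] plus_cper.rep_eq algebra_simps)
  ultimately show ?thesis
    by (intro bounded_linear_intro[where K = b]) (auto simp: mult.commute)
qed

text \<open>Near \<open>x0\<close> the product \<open>C * sqrt (w x)\<close> drops below 1;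
  multiplying by \<open>sqrt (w x)\<close>, positive away from \<open>x0\<close>, gives the strict
  inequality.\<close>

lemma sqrt_modulus_not_linear:
  fixes w :: "real \<Rightarrow> real"
  assumes cont: "continuous_on UNIV w" and w0: "w x0 = 0"
    and pos: "\<forall>\<^sub>F x in at x0. w x > 0"
  shows "\<exists>x. C * w x < sqrt (w x)"
proof -
  have "isCont w x0" using cont by (simp add: continuous_on_eq_continuous_at)
  then have "(w \<longlongrightarrow> 0) (at x0)" using w0 by (simp add: isCont_def)
  then have "((\<lambda>x. C * sqrt (w x)) \<longlongrightarrow> C * sqrt 0) (at x0)"
    by (intro tendsto_intros)
  then have "\<forall>\<^sub>F x in at x0. C * sqrt (w x) < 1"
    by (intro order_tendstoD(2)) auto
  with pos have "\<forall>\<^sub>F x in at x0. C * w x < sqrt (w x)"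
  proof eventually_elim
    case (elim x)
    then have "C * sqrt (w x) * sqrt (w x) < 1 * sqrt (w x)"
      by (intro mult_strict_right_mono) auto
    then show ?case using elim by (simp add: mult.assoc)
  qed
  then show ?thesis using eventually_happens'[OF at_neq_bot] by blast
qed

lemma continuous_periodic_bounded_below:
  fixes f :: "real \<Rightarrow> complex"
  assumes cont: "continuous_on UNIV f" and per: "\<And>x. f (x + 2 * pi) = f x"
    and nz: "\<And>x. f x \<noteq> 0"
  obtains d where "d > 0" "\<And>x. d \<le> norm (f x)"
proof -
  have "\<exists>x\<in>{-pi..pi}. \<forall>y\<in>{-pi..pi}. norm (f x) \<le> norm (f y)"
    by (intro continuous_attains_inf continuous_intros continuous_on_subset[OF cont]) auto
  then obtain x where x: "\<And>y. y \<in> {-pi..pi} \<Longrightarrow> norm (f x) \<le> norm (f y)" by blast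
  show ?thesis
  proof
    show "norm (f x) > 0" using nz by simp
    show "norm (f x) \<le> norm (f y)" for y
      using x periodic_obtain[of f y] per by metis
  qed
qed

text \<open>By \<open>modulus\<close>, \<open>K\<close> maps the unit ball to an equicontinuous
  family. The modulus is kept as an explicit function because both inclusions use it: its sublevel
  sets carry the partition of unity, and it is a summand of the modulus at a spectral point.\<close>

locale multiplication_plus_equicontinuous =
  fixes m n :: "real \<Rightarrow> complex" and K :: "cper \<Rightarrow> cper" and \<kappa> :: "real \<Rightarrow> real \<Rightarrow> real"
  assumes m: "continuous_on UNIV m" "\<And>x. m (x + 2 * pi) = m x"
    and n: "continuous_on UNIV n" "\<And>x. n (x + 2 * pi) = n x"
    and K: "bounded_linear K" "\<And>c f. K (scaleC_cper c f) = scaleC_cper c (K f)"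
    and \<kappa>: "\<And>y. continuous_on UNIV (\<lambda>x. \<kappa> x y)" "\<And>x y. \<kappa> (x + 2 * pi) y = \<kappa> x y"
      "\<And>x. \<kappa> x x = 0"
    and modulus: "\<And>f x y. norm (apply_cper (K f) x - apply_cper (K f) y) \<le> \<kappa> x y * norm f"
begin

text \<open>Forced by \<open>modulus\<close> at any nonzero function; the constant function (1, 1)
  serves.\<close>

lemma modulus_nonneg: "\<kappa> x y \<ge> 0"
proof -
  have one: "apply_cper (Abs_cper (\<lambda>x. (1, 1))) 0 = (1, 1)" by (rule Abs_cper_apply) auto
  have pos: "norm (Abs_cper (\<lambda>x. (1, 1))) > 0"
  proof (rule less_le_trans)
    show "0 < norm (1 :: complex, 1 :: complex)" by (simp add: zero_prod_def)
    show "norm (1 :: complex, 1 :: complex) \<le> norm (Abs_cper (\<lambda>x. (1, 1)))"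
      using norm_apply_cper_le[of "Abs_cper (\<lambda>x. (1, 1))" 0] unfolding one .
  qed
  have "0 \<le> \<kappa> x y * norm (Abs_cper (\<lambda>x. (1, 1)))"
    using modulus norm_ge_zero order_trans by blast
  then show ?thesis using pos by (simp add: zero_le_mult_iff)
qed

text \<open>A partition of unity subordinate to the sets \<open>{x. \<kappa> x y < \<epsilon>}\<close> interpolates
  \<open>K f\<close> from its values at finitely many points.\<close>

lemma finite_rank_approximation:
  assumes "\<epsilon> > 0"
  obtains F B where "bounded_linear F" "\<And>c f. F (scaleC_cper c f) = scaleC_cper c (F f)"
    "finite B" "\<And>f. F f \<in> cper.span B" "\<And>f. norm (K f - F f) \<le> \<epsilon> * norm f"
proof -
  have op: "open {x. \<kappa> x y < \<epsilon>}" for y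
    using open_Collect_less[OF \<kappa>(1) continuous_on_const] by simp
  have cov: "{-pi..pi} \<subseteq> (\<Union>y\<in>{-pi..pi}. {x. \<kappa> x y < \<epsilon>})"
  proof
    fix x :: real assume "x \<in> {-pi..pi}"
    then show "x \<in> (\<Union>y\<in>{-pi..pi}. {x. \<kappa> x y < \<epsilon>})" using \<kappa>(3)[of x] assms by force
  qed
  obtain I where "I \<subseteq> {-pi..pi}" and I: "finite I" "{-pi..pi} \<subseteq> (\<Union>y\<in>I. {x. \<kappa> x y < \<epsilon>})"
    by (rule compactE_image[OF compact_Icc op cov])
  define \<psi> where "\<psi> y x = max 0 (\<epsilon> - \<kappa> x y)" for y x
  define s where "s x = (\<Sum>y\<in>I. \<psi> y x)" for x
  define \<phi> where "\<phi> y x = \<psi> y x / s x" for y x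
  have \<psi>: "\<psi> y x \<ge> 0" "\<psi> y (x + 2 * pi) = \<psi> y x" "continuous_on UNIV (\<psi> y)" for x y
    unfolding \<psi>_def by (auto simp: \<kappa>(2) intro!: continuous_intros \<kappa>(1))
  have s_per: "s (x + 2 * pi) = s x" for x by (simp add: s_def \<psi>(2))
  \<comment> \<open>The sublevel sets cover one period only; periodicity of \<open>s\<close> carries
    positivity to the whole line.\<close>
  have s_pos: "s x > 0" for x
  proof -
    obtain x' where x': "x' \<in> {-pi..pi}" "s x = s x'"
      using periodic_obtain[of s x] s_per by blast
    then obtain y where "y \<in> I" "\<kappa> x' y < \<epsilon>" using I(2) by blast
    then have "s x' > 0"
      unfolding s_def using I(1) \<psi>(1) by (intro sum_pos2[of I y]) (auto simp: \<psi>_def)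
    then show ?thesis using x' by simp
  qed
  have \<phi>: "\<phi> y x \<ge> 0" "\<phi> y (x + 2 * pi) = \<phi> y x" "continuous_on UNIV (\<phi> y)" for x y
    using s_pos \<psi> s_per unfolding \<phi>_def s_def[abs_def]
    by (auto simp: less_imp_le less_imp_neq[symmetric] intro!: continuous_intros \<psi>(3) divide_nonneg_pos)
  have sum1: "(\<Sum>y\<in>I. \<phi> y x) = 1" for x
    using s_pos[of x] unfolding \<phi>_def sum_divide_distrib[symmetric] s_def[symmetric] by simp
  \<comment> \<open>Where \<open>\<kappa> x y\<close> reaches \<open>\<epsilon>\<close> the weight
    \<open>\<phi> y x\<close> is zero, so only nearby interpolation points contribute to the
    error.\<close>
  have \<phi>\<kappa>: "\<phi> y x * \<kappa> x y \<le> \<epsilon> * \<phi> y x" for x y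
  proof (cases "\<kappa> x y < \<epsilon>")
    case True
    then show ?thesis using \<phi>(1)[of y x] mult_left_mono[of "\<kappa> x y" \<epsilon> "\<phi> y x"] by (simp add: mult.commute)
  next
    case False
    then show ?thesis by (simp add: \<phi>_def \<psi>_def)
  qed
  define e1 e2 where "e1 y = Abs_cper (\<lambda>x. (of_real (\<phi> y x), 0))"
    and "e2 y = Abs_cper (\<lambda>x. (0, of_real (\<phi> y x)))" for y
  have e: "apply_cper (e1 y) x = (of_real (\<phi> y x), 0)" "apply_cper (e2 y) x = (0, of_real (\<phi> y x))"
    for x y
    unfolding e1_def e2_def by (auto intro!: Abs_cper_apply continuous_intros \<phi>)
  define F where "F f = (\<Sum>y\<in>I. scaleC_cper (fst (apply_cper (K f) y)) (e1 y)
      + scaleC_cper (snd (apply_cper (K f) y)) (e2 y))" for f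
  have aF: "apply_cper (F f) x = (\<Sum>y\<in>I. \<phi> y x *\<^sub>R apply_cper (K f) y)" for f x
    unfolding F_def
    by (intro trans[OF apply_cper_sum] sum.cong)
      (auto simp: plus_cper.rep_eq scaleC_cper.rep_eq e prod_eq_iff scaleR_conv_of_real)
  show ?thesis
  proof
    have ev: "bounded_linear (\<lambda>f. apply_cper (K f) y)" for y
      by (rule bounded_linear_compose[OF bounded_linear_apply_cper K(1)])
    show "bounded_linear F"
      unfolding F_def
      by (intro bounded_linear_sum bounded_linear_add
          bounded_linear_compose[OF cper.bounded_linear_scale_left]
          bounded_linear_compose[OF bounded_linear_fst ev] bounded_linear_compose[OF bounded_linear_snd ev])
    show "F (scaleC_cper c f) = scaleC_cper c (F f)" for c f
      unfolding F_def
      by (simp add: K(2) scaleC_cper.rep_eq cper.scale_sum_right cper.scale_right_distrib)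
    show "finite (e1 ` I \<union> e2 ` I)" using I by simp
    show "F f \<in> cper.span (e1 ` I \<union> e2 ` I)" for f
      unfolding F_def
      by (intro cper.span_sum cper.span_add cper.span_scale cper.span_base) auto
    show "norm (K f - F f) \<le> \<epsilon> * norm f" for f
    proof (rule norm_cper_le)
      fix x
      \<comment> \<open>As the weights sum to 1, the error is the weighted average of the increments
        of \<open>K f\<close> from the points of \<open>I\<close> to \<open>x\<close>.\<close>
      have "apply_cper (K f - F f) x
          = (\<Sum>y\<in>I. \<phi> y x) *\<^sub>R apply_cper (K f) x - (\<Sum>y\<in>I. \<phi> y x *\<^sub>R apply_cper (K f) y)"
        by (simp add: minus_cper.rep_eq aF sum1)
      also have "\<dots> = (\<Sum>y\<in>I. \<phi> y x *\<^sub>R (apply_cper (K f) x - apply_cper (K f) y))"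
        by (simp add: scaleR_sum_left scaleR_diff_right sum_subtractf)
      also have "norm \<dots> \<le> (\<Sum>y\<in>I. \<phi> y x * (\<kappa> x y * norm f))"
        by (intro sum_norm_le) (simp add: \<phi>(1) mult_left_mono modulus)
      also have "\<dots> \<le> (\<Sum>y\<in>I. \<epsilon> * \<phi> y x * norm f)"
        using \<phi>\<kappa> by (intro sum_mono) (simp add: mult_right_mono flip: mult.assoc)
      also have "\<dots> = \<epsilon> * norm f"
        using sum1[of x] by (simp flip: sum_distrib_left sum_distrib_right)
      finally show "norm (apply_cper (K f - F f) x) \<le> \<epsilon> * norm f" .
    qed
  qed
qed

lemma fredholm_index_zero_off_range:
  assumes "\<mu> \<notin> range m" "\<mu> \<notin> range n"
  defines "L \<equiv> \<lambda>f. mult_cper m n f + K f - scaleC_cper \<mu> f"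
  shows "cper.fredholm L" and "cper.fredholm_index L = 0"
proof -
  define p q where "p x = m x - \<mu>" and "q x = n x - \<mu>" for x
  have p: "continuous_on UNIV p" "\<And>x. p (x + 2 * pi) = p x" "\<And>x. p x \<noteq> 0"
    and q: "continuous_on UNIV q" "\<And>x. q (x + 2 * pi) = q x" "\<And>x. q x \<noteq> 0"
    unfolding p_def q_def using assms(1,2) m n by (auto intro!: continuous_intros)
  obtain d1 d2 where d12: "d1 > 0" "d2 > 0" "\<And>x. d1 \<le> norm (p x)" "\<And>x. d2 \<le> norm (q x)"
    using continuous_periodic_bounded_below[OF p] continuous_periodic_bounded_below[OF q] by metis
  define d where "d = min d1 d2"
  have d: "d > 0" "\<And>x. d \<le> norm (p x)" "\<And>x. d \<le> norm (q x)"
    using d12 by (auto simp: d_def min.coboundedI1 min.coboundedI2)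
  define M where "M = mult_cper p q"
  define N where "N = mult_cper (\<lambda>x. inverse (p x)) (\<lambda>x. inverse (q x))"
  have aM: "apply_cper (M f) x = (p x * fst (apply_cper f x), q x * snd (apply_cper f x))" for f x
    unfolding M_def by (intro apply_mult_cper p q)
  have aN: "apply_cper (N f) x
      = (inverse (p x) * fst (apply_cper f x), inverse (q x) * snd (apply_cper f x))" for f x
    unfolding N_def by (intro apply_mult_cper continuous_intros p q) (auto simp: p q)
  have MN: "M (N f) = f" and NM: "N (M f) = f" for f
    by (rule cper_eqI, simp add: aM aN p q prod_eq_iff)+
  have Ndiff: "N (f - g) = N f - N g" for f g
    by (rule cper_eqI) (simp add: aN minus_cper.rep_eq algebra_simps)
  have normN: "norm (N f) \<le> inverse d * norm f" for f
    unfolding N_def using d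
    by (intro norm_mult_cper_le continuous_intros p q)
      (auto simp: p q norm_inverse intro!: le_imp_inverse_le)
  \<comment> \<open>The inverse \<open>N\<close> of \<open>M\<close> has norm at most
    \<open>inverse d\<close>. The accuracy \<open>d / 2\<close> therefore leaves a remainder
    \<open>R\<close> with \<open>N R\<close> of norm at most 1/2, so that \<open>S = M + R\<close>
    stays invertible, with the lower bound constant \<open>2 / d\<close>.\<close>
  obtain F B where F: "bounded_linear F" "\<And>c f. F (scaleC_cper c f) = scaleC_cper c (F f)"
    and B: "finite B" "\<And>f. F f \<in> cper.span B" and FK: "\<And>f. norm (K f - F f) \<le> d / 2 * norm f"
    using finite_rank_approximation[of "d / 2"] d(1) by auto
  define R where "R f = K f - F f" for f
  have R: "bounded_linear R" unfolding R_def by (intro bounded_linear_sub K F)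
  have Rhom: "R (scaleC_cper c f) = scaleC_cper c (R f)" for c f
    by (simp add: R_def K F cper.scale_right_diff_distrib)
  define S where "S f = M f + R f" for f
  have Mhom: "M (scaleC_cper c f) = scaleC_cper c (M f)" for c f
    unfolding M_def by (intro mult_cper_scaleC p q)
  have low: "norm f \<le> 2 / d * norm (S f)" for f
  proof -
    have "norm f \<le> inverse d * norm (M f)" using normN[of "M f"] by (simp add: NM)
    then have "d * norm f \<le> norm (M f)" using d(1) by (simp add: field_simps)
    also have "M f = S f - R f" by (simp add: S_def)
    also have "norm \<dots> \<le> norm (S f) + d / 2 * norm f"
      using FK[of f] norm_triangle_ineq4[of "S f" "R f"] by (simp add: R_def)
    finally show ?thesis using d(1) by (simp add: field_simps)
  qed
  have bM: "bounded_linear M" unfolding M_def by (intro bounded_linear_mult_cper p q)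
  have "surj S"
    unfolding surj_def
  proof
    fix g
    \<comment> \<open>The equation \<open>S f = g\<close> is the fixed point equation
      \<open>f = N (g - R f)\<close>, a contraction with constant 1/2.\<close>
    have "dist (N (g - R f)) (N (g - R f')) \<le> 1 / 2 * dist f f'" for f f'
    proof -
      have "N (g - R f) - N (g - R f') = N (R (f' - f))"
        using R by (simp add: linear_simps flip: Ndiff)
      also have "norm \<dots> \<le> inverse d * (d / 2 * norm (f' - f))"
        using FK[of "f' - f"] d(1) unfolding R_def[symmetric]
        by (intro order_trans[OF normN] mult_left_mono) auto
      also have "\<dots> = 1 / 2 * norm (f' - f)" using d(1) by simp
      finally show ?thesis by (simp only: dist_norm norm_minus_commute)
    qed
    then obtain f where f: "N (g - R f) = f"
      using banach_fix_type[of "1 / 2" "\<lambda>f. N (g - R f)"] by auto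
    then have "M f = g - R f" using MN by metis
    then show "\<exists>f. g = S f" by (intro exI[of _ f]) (simp add: S_def)
  qed
  moreover have "bounded_linear S" unfolding S_def by (intro bounded_linear_add bM R)
  moreover have "S (scaleC_cper c f) = scaleC_cper c (S f)" for c f
    by (simp add: S_def Mhom Rhom cper.scale_right_distrib)
  moreover have "L = (\<lambda>f. S f + F f)"
  proof (intro ext cper_eqI)
    fix f x
    show "apply_cper (L f) x = apply_cper (S f + F f) x"
      by (simp add: L_def S_def R_def aM apply_mult_cper[OF m(1) n(1) m(2) n(2)] p_def q_def plus_cper.rep_eq
          minus_cper.rep_eq scaleC_cper.rep_eq prod_eq_iff algebra_simps)
  qed
  ultimately show "cper.fredholm L" "cper.fredholm_index L = 0"
    using cper.fredholm_bijective_plus_finite_rank[OF _ _ _ low F B] by auto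
qed

text \<open>If \<open>m x\<^sub>0 = \<mu>\<close>, then modulo a finite-dimensional space every element of the range is
  \<open>O(w)\<close> at \<open>x\<^sub>0\<close> for a single modulus of continuity \<open>w\<close>; but \<open>sqrt w\<close> is not.
  The linear map \<open>sel\<close> picks one of the two components.\<close>

lemma range_not_finite_codim:
  assumes sel: "linear sel" "\<And>v. norm (sel v) \<le> norm v" "\<And>c. sel (c, c) = c"
    and g: "continuous_on UNIV g" "\<And>x. g (x + 2 * pi) = g x" "g x0 = \<mu>"
    and sel_mult: "\<And>f x. sel (apply_cper (mult_cper m n f - scaleC_cper \<mu> f) x)
        = (g x - \<mu>) * sel (apply_cper f x)"
  shows "\<not> cper.finite_codim (range (\<lambda>f. mult_cper m n f + K f - scaleC_cper \<mu> f))"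
proof
  let ?L = "\<lambda>f. mult_cper m n f + K f - scaleC_cper \<mu> f"
  assume "cper.finite_codim (range ?L)"
  then obtain B where B: "finite B" and dec: "\<And>v. \<exists>f. \<exists>u\<in>cper.span B. v = ?L f + u"
    unfolding cper.finite_codim_def cper.complementary_def cper.finite_dim_def by fast
  define \<beta> where "\<beta> x = (\<Sum>b\<in>B. norm (apply_cper b x - apply_cper b x0))" for x
  \<comment> \<open>One summand for each source of variation: the multiplier, \<open>K\<close>, and
    the complement spanned by \<open>B\<close>. The half-angle sine makes \<open>w\<close> positive
    near \<open>x0\<close> except at \<open>x0\<close>, and its absolute value has period
    \<open>2 * pi\<close>.\<close>
  define w where "w x = norm (g x - \<mu>) + \<kappa> x x0 + \<bar>sin ((x - x0) / 2)\<bar> + \<beta> x" for x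
  have \<beta>: "\<beta> x \<ge> 0" for x unfolding \<beta>_def by (intro sum_nonneg) auto
  have w_cont: "continuous_on UNIV w"
    unfolding w_def \<beta>_def by (intro continuous_intros g \<kappa> apply_cper_continuous) auto
  have w_per: "w (x + 2 * pi) = w x" for x
  proof -
    have "(x + 2 * pi - x0) / 2 = (x - x0) / 2 + pi" by (simp add: field_simps)
    then have "\<bar>sin ((x + 2 * pi - x0) / 2)\<bar> = \<bar>sin ((x - x0) / 2)\<bar>" by (simp only: sin_periodic_pi abs_minus)
    then show ?thesis unfolding w_def \<beta>_def by (simp only: g \<kappa> apply_cper_periodic)
  qed
  have w0: "w x0 = 0" by (simp add: w_def \<beta>_def g \<kappa>)
  have w_pos: "\<forall>\<^sub>F x in at x0. w x > 0"
    unfolding eventually_at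
  proof (intro exI conjI ballI impI)
    fix x assume "x \<noteq> x0 \<and> dist x x0 < 2 * pi"
    then have "0 < \<bar>(x - x0) / 2\<bar>" "\<bar>(x - x0) / 2\<bar> < pi" by (auto simp: dist_real_def)
    then have "sin \<bar>(x - x0) / 2\<bar> \<noteq> 0" using sin_gt_zero[of "\<bar>(x - x0) / 2\<bar>"] by linarith
    then have "sin ((x - x0) / 2) \<noteq> 0" by (simp add: abs_if split: if_splits)
    then show "w x > 0"
      unfolding w_def using \<beta>[of x] modulus_nonneg[of x x0]
      by (smt (verit) norm_ge_zero)
  qed simp
  \<comment> \<open>The constant depends on \<open>u\<close> but the modulus \<open>\<beta>\<close>
    does not; it is fixed by the finite set \<open>B\<close>.\<close>
  have small: "\<exists>C. \<forall>x. norm (apply_cper u x - apply_cper u x0) \<le> C * \<beta> x"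
    if "u \<in> cper.span B" for u
    using that
  proof (induction rule: cper.span_induct_alt)
    case base
    show ?case by (intro exI[of _ 0]) (simp add: zero_cper.rep_eq)
  next
    case (step c b u)
    then obtain C where C: "\<And>x. norm (apply_cper u x - apply_cper u x0) \<le> C * \<beta> x" by blast
    have "norm (apply_cper (scaleC_cper c b + u) x - apply_cper (scaleC_cper c b + u) x0)
        \<le> (norm c + C) * \<beta> x" for x
    proof -
      have "apply_cper (scaleC_cper c b + u) x - apply_cper (scaleC_cper c b + u) x0
          = (c * (fst (apply_cper b x - apply_cper b x0)), c * (snd (apply_cper b x - apply_cper b x0)))
            + (apply_cper u x - apply_cper u x0)"
        by (simp add: plus_cper.rep_eq scaleC_cper.rep_eq prod_eq_iff algebra_simps)
      also have "norm \<dots> \<le> norm c * norm (apply_cper b x - apply_cper b x0) + C * \<beta> x"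
        by (intro norm_triangle_mono C)
          (simp add: norm_prod_def norm_mult power_mult_distrib real_sqrt_mult flip: distrib_left)
      also have "\<dots> \<le> norm c * \<beta> x + C * \<beta> x"
        unfolding \<beta>_def using B step by (intro add_right_mono mult_left_mono member_le_sum) auto
      finally show ?thesis by (simp add: distrib_right)
    qed
    then show ?case by blast
  qed
  \<comment> \<open>Both components are equal, so that \<open>sel\<close> yields
    \<open>sqrt (w x)\<close> whichever component it selects.\<close>
  define v where "v = Abs_cper (\<lambda>x. (of_real (sqrt (w x)), of_real (sqrt (w x))))"
  have av: "apply_cper v x = (of_real (sqrt (w x)), of_real (sqrt (w x)))" for x
    unfolding v_def by (intro Abs_cper_apply continuous_intros w_cont) (simp_all add: w_per)
  obtain f u where u: "u \<in> cper.span B" and v: "v = ?L f + u" using dec by blast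
  obtain C where C: "\<And>x. norm (apply_cper u x - apply_cper u x0) \<le> C * \<beta> x"
    using small[OF u] by blast
  have w_nonneg: "w x \<ge> 0" for x unfolding w_def using \<beta>[of x] modulus_nonneg[of x x0] by simp
  have "sqrt (w x) \<le> (norm f + \<bar>C\<bar>) * w x" for x
  proof -
    have selv: "sel (apply_cper v y) = (g y - \<mu>) * sel (apply_cper f y)
        + sel (apply_cper (K f) y) + sel (apply_cper u y)" for y
    proof -
      have "apply_cper v y = apply_cper (mult_cper m n f - scaleC_cper \<mu> f) y
          + apply_cper (K f) y + apply_cper u y"
        by (simp add: v plus_cper.rep_eq minus_cper.rep_eq)
      then show ?thesis by (simp add: linear_add[OF sel(1)] sel_mult)
    qed
    \<comment> \<open>The value at \<open>x0\<close> is subtracted at no cost, since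
      \<open>w x0 = 0\<close>. There the multiplication term vanishes because
      \<open>g x0 = \<mu>\<close>, and each remaining term is bounded by a summand of
      \<open>w\<close>.\<close>
    have "sqrt (w x) = norm (sel (apply_cper v x) - sel (apply_cper v x0))"
      by (simp add: av sel(3) w0 w_nonneg)
    also have "sel (apply_cper v x) - sel (apply_cper v x0) = (g x - \<mu>) * sel (apply_cper f x)
        + sel (apply_cper (K f) x - apply_cper (K f) x0) + sel (apply_cper u x - apply_cper u x0)"
      by (simp add: selv g(3) linear_diff[OF sel(1)])
    also have "norm \<dots> \<le> norm (g x - \<mu>) * norm f + \<kappa> x x0 * norm f + C * \<beta> x"
      unfolding norm_mult
      by (intro norm_triangle_mono order_trans[OF sel(2)] modulus C)
        (simp add: norm_mult mult_left_mono order_trans[OF sel(2)] norm_apply_cper_le)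
    also have "\<dots> \<le> norm (g x - \<mu>) * (norm f + \<bar>C\<bar>) + \<kappa> x x0 * (norm f + \<bar>C\<bar>)
        + \<bar>sin ((x - x0) / 2)\<bar> * (norm f + \<bar>C\<bar>) + (norm f + \<bar>C\<bar>) * \<beta> x"
    proof -
      have "C \<le> norm f + \<bar>C\<bar>" using norm_ge_zero[of f] by linarith
      then have "C * \<beta> x \<le> (norm f + \<bar>C\<bar>) * \<beta> x" using \<beta> by (rule mult_right_mono)
      moreover have "norm (g x - \<mu>) * norm f \<le> norm (g x - \<mu>) * (norm f + \<bar>C\<bar>)"
        "\<kappa> x x0 * norm f \<le> \<kappa> x x0 * (norm f + \<bar>C\<bar>)"
        "0 \<le> \<bar>sin ((x - x0) / 2)\<bar> * (norm f + \<bar>C\<bar>)"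
        using modulus_nonneg[of x x0] by (auto intro!: mult_left_mono)
      ultimately show ?thesis by linarith
    qed
    also have "\<dots> = (norm f + \<bar>C\<bar>) * w x" by (simp add: w_def algebra_simps)
    finally show ?thesis .
  qed
  moreover obtain x where "(norm f + \<bar>C\<bar>) * w x < sqrt (w x)"
    using sqrt_modulus_not_linear[OF w_cont w0 w_pos] by blast
  ultimately show False using not_less by blast
qed

theorem essential_spectrum_eq:
  "cper.essential_spectrum (\<lambda>f. mult_cper m n f + K f) = range m \<union> range n"
proof (intro equalityI subsetI)
  fix \<mu> assume "\<mu> \<in> cper.essential_spectrum (\<lambda>f. mult_cper m n f + K f)"
  then show "\<mu> \<in> range m \<union> range n"
    using fredholm_index_zero_off_range[of \<mu>] unfolding cper.essential_spectrum_def by blast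
next
  fix \<mu> assume "\<mu> \<in> range m \<union> range n"
  then consider x0 where "m x0 = \<mu>" | x0 where "n x0 = \<mu>" by blast
  then have "\<not> cper.finite_codim (range (\<lambda>f. mult_cper m n f + K f - scaleC_cper \<mu> f))"
  proof cases
    case 1
    show ?thesis
      by (rule range_not_finite_codim[of fst m x0])
        (use m n 1 in \<open>auto simp: apply_mult_cper minus_cper.rep_eq scaleC_cper.rep_eq norm_fst_le
          algebra_simps intro: linearI\<close>)
  next
    case 2
    show ?thesis
      by (rule range_not_finite_codim[of snd n x0])
        (use m n 2 in \<open>auto simp: apply_mult_cper minus_cper.rep_eq scaleC_cper.rep_eq norm_snd_le
          algebra_simps intro: linearI\<close>)
  qed
  then show "\<mu> \<in> cper.essential_spectrum (\<lambda>f. mult_cper m n f + K f)"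
    unfolding cper.essential_spectrum_def cper.fredholm_def by blast
qed

end

section \<open>The monodromy operator\<close>

lemma continuous_on_integral_param:
  fixes f :: "'a::topological_space \<Rightarrow> real \<Rightarrow> 'b::banach"
  assumes "continuous_on UNIV (\<lambda>(x, u). f x u)"
  shows "continuous_on S (\<lambda>x. integral {a..b} (f x))"
  using integral_continuous_on_param[of S a b f] continuous_on_subset[OF assms]
  by (simp add: box_real)

lemma iterated_integral_diff_le:
  fixes f g :: "real \<Rightarrow> real \<Rightarrow> 'a::banach" and r :: "real \<Rightarrow> real \<Rightarrow> real"
  assumes f: "continuous_on UNIV (\<lambda>(s, u). f s u)" and g: "continuous_on UNIV (\<lambda>(s, u). g s u)"
    and r: "continuous_on UNIV (\<lambda>(s, u). r s u)"
    and le: "\<And>s u. \<lbrakk>s \<in> {a..b}; u \<in> {c..d}\<rbrakk> \<Longrightarrow> norm (f s u - g s u) \<le> r s u"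
  shows "norm (integral {a..b} (\<lambda>s. integral {c..d} (f s)) - integral {a..b} (\<lambda>s. integral {c..d} (g s)))
    \<le> integral {a..b} (\<lambda>s. integral {c..d} (r s))"
proof -
  have slice: "continuous_on S (k s)"
    if k: "continuous_on UNIV (\<lambda>(s, u). k s u)" for k :: "real \<Rightarrow> real \<Rightarrow> 'c::banach" and s S
  proof -
    have "continuous_on S (\<lambda>u. (s, u))" by (intro continuous_intros)
    from continuous_on_compose2[OF k this] show ?thesis by simp
  qed
  have int: "k s integrable_on {c..d}" "(\<lambda>s. integral {c..d} (k s)) integrable_on {a..b}"
    if "continuous_on UNIV (\<lambda>(s, u). k s u)" for k :: "real \<Rightarrow> real \<Rightarrow> 'c::banach" and s
    using slice[OF that] continuous_on_integral_param[OF that]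
    by (auto intro!: integrable_continuous_interval)
  have "integral {a..b} (\<lambda>s. integral {c..d} (f s)) - integral {a..b} (\<lambda>s. integral {c..d} (g s))
      = integral {a..b} (\<lambda>s. integral {c..d} (f s) - integral {c..d} (g s))"
    by (intro Henstock_Kurzweil_Integration.integral_diff[symmetric] int f g)
  also have "norm \<dots> \<le> integral {a..b} (\<lambda>s. integral {c..d} (r s))"
  proof (intro integral_norm_bound_integral integrable_diff int f g r)
    fix s assume s: "s \<in> {a..b}"
    have "integral {c..d} (f s) - integral {c..d} (g s) = integral {c..d} (\<lambda>u. f s u - g s u)"
      by (intro Henstock_Kurzweil_Integration.integral_diff[symmetric] int f g)
    also have "norm \<dots> \<le> integral {c..d} (r s)"
      using le[OF s] by (intro integral_norm_bound_integral integrable_diff int f g r) auto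
    finally show "norm (integral {c..d} (f s) - integral {c..d} (g s)) \<le> integral {c..d} (r s)" .
  qed
  finally show ?thesis .
qed

lemma continuous_on_component:
  assumes V: "continuous_on UNIV V" and sel: "bounded_linear sel"
  shows "continuous_on UNIV (\<lambda>(x, t). sel (apply_cper (V t) x))"
  using bounded_linear.continuous_on[OF sel continuous_on_apply_cper[OF V]]
  by (simp add: case_prod_unfold)

text \<open>Passing through \<open>cper\<close>-valued functions makes the antiderivative jointly continuous.\<close>

lemma joint_antiderivative:
  fixes h :: "real \<Rightarrow> real \<Rightarrow> complex"
  assumes h: "continuous_on UNIV (\<lambda>(x, t). h x t)" "\<And>x t. h (x + 2 * pi) t = h x t"
  obtains H where "continuous_on UNIV (\<lambda>(x, t). H x t)" "\<And>x t. H (x + 2 * pi) t = H x t"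
    "\<And>x. H x 0 = 0" "\<And>x t. (H x has_vector_derivative h x t) (at t)"
proof -
  define k where "k t = Abs_cper (\<lambda>x. (h x t, 0))" for t
  have k: "apply_cper (k t) x = (h x t, 0)" for x t
    unfolding k_def by (intro Abs_cper_apply continuous_slice[OF h(1)]) (auto simp: h(2))
  have "continuous_on UNIV k"
    by (rule continuous_on_cperI) (use h(1) in \<open>auto simp: k case_prod_unfold intro!: continuous_intros\<close>)
  then obtain F where F: "F 0 = 0" "\<And>t. (F has_vector_derivative k t) (at t)"
    using antiderivative_exists by blast
  have contF: "continuous_on UNIV F"
    using F(2) by (intro continuous_at_imp_continuous_on ballI) (auto intro: has_vector_derivative_continuous)
  show ?thesis
  proof
    show "continuous_on UNIV (\<lambda>(x, t). fst (apply_cper (F t) x))"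
      by (rule continuous_on_component[OF contF bounded_linear_fst])
    show "((\<lambda>t. fst (apply_cper (F t) x)) has_vector_derivative h x t) (at t)" for x t
      using bounded_linear.has_vector_derivative
        [OF bounded_linear_compose[OF bounded_linear_fst bounded_linear_apply_cper] F(2)]
      by (simp add: k)
  qed (simp_all add: apply_cper_periodic F(1) zero_cper.rep_eq)
qed

lemma coupling_cmult: "coupling G (\<lambda>y. c * u y) x = c * coupling G u x"
proof -
  have "coupling G (\<lambda>y. c * u y) x = integral {-pi..pi} (\<lambda>y. c * (of_real (G (x - y)) * u y))"
    by (simp add: coupling_def ac_simps)
  then show ?thesis by (simp add: coupling_def)
qed

lemma coupling_integrand_continuous:
  fixes u :: "real \<Rightarrow> complex"
  assumes G: "continuous_on UNIV G" and "continuous_on UNIV u"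
  shows "continuous_on S (\<lambda>y. of_real (G (x - y)) * u y)"
  using assms(2) continuous_on_subset
  by (intro continuous_intros continuous_on_compose2[OF G]) auto

lemma coupling_add:
  assumes G: "continuous_on UNIV G" and "continuous_on UNIV u" "continuous_on UNIV v"
  shows "coupling G (\<lambda>y. u y + v y) x = coupling G u x + coupling G v x"
  unfolding coupling_def distrib_left
  by (intro Henstock_Kurzweil_Integration.integral_add integrable_continuous_interval
      coupling_integrand_continuous assms)

lemma norm_coupling_le:
  assumes G: "continuous_on UNIV G" and u: "continuous_on UNIV u"
    and "\<And>x. \<bar>G x\<bar> \<le> b" "\<And>x. norm (u x) \<le> c"
  shows "norm (coupling G u x) \<le> 2 * pi * b * c"
proof -
  have "norm (of_real (G (x - y)) * u y) \<le> b * c" for y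
    unfolding norm_mult using assms(3,4) order_trans[OF abs_ge_zero assms(3)]
    by (intro mult_mono) auto
  then show ?thesis
    unfolding coupling_def
    using integral_bound[OF _ coupling_integrand_continuous[OF G u], of "-pi" pi x "b * c"]
    by (simp add: ac_simps)
qed

text \<open>Periodicity in time as well as in space reduces to a compact rectangle. The resulting
  bounds hold for all times and supply the single constant that \<open>bounded_linear_ode\<close>
  asks for.\<close>

lemma doubly_periodic_bounded:
  fixes f :: "real \<Rightarrow> real \<Rightarrow> 'a::real_normed_vector"
  assumes cont: "continuous_on UNIV (\<lambda>(x, t). f x t)" and "p > 0" "q > 0"
    and per: "\<And>x t. f (x + p) t = f x t" "\<And>x t. f x (t + q) = f x t"
  obtains B where "\<And>x t. norm (f x t) \<le> B"
proof -
  have "compact ((\<lambda>(x, t). f x t) ` ({0..p} \<times> {0..q}))"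
    by (intro compact_continuous_image continuous_on_subset[OF cont] compact_Times) auto
  then have "bounded ((\<lambda>(x, t). f x t) ` ({0..p} \<times> {0..q}))" by (rule compact_imp_bounded)
  then obtain B where "\<forall>y\<in>(\<lambda>(x, t). f x t) ` ({0..p} \<times> {0..q}). norm y \<le> B"
    unfolding bounded_iff by blast
  then have B: "\<And>x t. \<lbrakk>x \<in> {0..p}; t \<in> {0..q}\<rbrakk> \<Longrightarrow> norm (f x t) \<le> B" by force
  have red: "x + of_int (- \<lfloor>x / r\<rfloor>) * r \<in> {0..r}" if "r > 0" for x r :: real
  proof -
    have "of_int \<lfloor>x / r\<rfloor> * r \<le> x" "x \<le> (of_int \<lfloor>x / r\<rfloor> + 1) * r"
      using that floor_divide_lower[of r x] floor_divide_upper[of r x] by auto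
    then show ?thesis by (simp add: algebra_simps)
  qed
  have "norm (f x t) \<le> B" for x t
  proof -
    have "f x t = f (x + of_int (- \<lfloor>x / p\<rfloor>) * p) t"
      using periodic_shift_int[of "\<lambda>x. f x t" p, OF per(1)] by metis
    also have "\<dots> = f (x + of_int (- \<lfloor>x / p\<rfloor>) * p) (t + of_int (- \<lfloor>t / q\<rfloor>) * q)"
      using periodic_shift_int[of "f (x + of_int (- \<lfloor>x / p\<rfloor>) * p)" q, OF per(2)] by metis
    finally show ?thesis using B red assms(2,3) by metis
  qed
  then show ?thesis using that by blast
qed

text \<open>Variation of constants: up to multiplication by the exponential, the time-\<open>T\<close> map of one
  component is an integral operator with continuous kernel, applied to the whole solution on
  \<open>[0, T]\<close>.\<close>

lemma variation_of_constants_modulus: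
  fixes h c1 c2 :: "real \<Rightarrow> real \<Rightarrow> complex" and V :: "cper \<Rightarrow> real \<Rightarrow> cper"
  assumes h: "continuous_on UNIV (\<lambda>(x, t). h x t)" "\<And>x t. h (x + 2 * pi) t = h x t"
    and c1: "continuous_on UNIV (\<lambda>(x, t). c1 x t)" "\<And>x t. c1 (x + 2 * pi) t = c1 x t"
    and c2: "continuous_on UNIV (\<lambda>(x, t). c2 x t)" "\<And>x t. c2 (x + 2 * pi) t = c2 x t"
    and G: "continuous_on UNIV G" "\<And>x. G (x + 2 * pi) = G x"
    and T: "T \<ge> 0"
    and V: "\<And>f. continuous_on UNIV (V f)" "\<And>f. V f 0 = f"
    and V_bound: "\<And>f t. t \<in> {0..T} \<Longrightarrow> norm (V f t) \<le> C * norm f"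
    and V_deriv: "\<And>f x t. ((\<lambda>t. sel (apply_cper (V f t) x)) has_vector_derivative
        - h x t * sel (apply_cper (V f t) x)
        + (c1 x t * coupling G (\<lambda>y. fst (apply_cper (V f t) y)) x
          + c2 x t * coupling G (\<lambda>y. snd (apply_cper (V f t) y)) x)) (at t)"
  defines "R \<equiv> \<lambda>f x. sel (apply_cper (V f T) x) - exp (- integral {0..T} (h x)) * sel (apply_cper f x)"
  shows "\<exists>\<kappa>. (\<forall>y. continuous_on UNIV (\<lambda>x. \<kappa> x y)) \<and> (\<forall>x y. \<kappa> (x + 2 * pi) y = \<kappa> x y)
    \<and> (\<forall>x. \<kappa> x x = 0) \<and> (\<forall>f x y. norm (R f x - R f y) \<le> \<kappa> x y * norm f)"
proof -
  obtain H where H: "continuous_on UNIV (\<lambda>(x, t). H x t)" "\<And>x t. H (x + 2 * pi) t = H x t"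
    "\<And>x. H x 0 = 0" and H_deriv: "\<And>x t. (H x has_vector_derivative h x t) (at t)"
    using joint_antiderivative[OF h] by metis
  have int_h: "integral {0..T} (h x) = H x T" for x
    using fundamental_theorem_of_calculus[OF T has_vector_derivative_at_within[OF H_deriv]] H(3)
    by (metis diff_zero integral_unique)
  \<comment> \<open>The factor \<open>exp (H x s - H x T)\<close> propagates
    \<open>v' = - h v\<close> from time \<open>s\<close> to time \<open>T\<close>; together with the
    coefficient and \<open>G\<close> it forms the kernel of the Duhamel integral.\<close>
  define k1 where "k1 x s u = exp (H x s - H x T) * c1 x s * of_real (G (x - u))" for x s u
  define k2 where "k2 x s u = exp (H x s - H x T) * c2 x s * of_real (G (x - u))" for x s u
  have jc: "continuous_on S (\<lambda>p. k (\<alpha> p) (\<beta> p))"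
    if "continuous_on UNIV (\<lambda>(x, t). k x t)" "continuous_on S \<alpha>" "continuous_on S \<beta>"
    for k :: "real \<Rightarrow> real \<Rightarrow> complex" and \<alpha> \<beta> :: "'c::topological_space \<Rightarrow> real" and S
    using continuous_on_compose2[OF that(1), of S "\<lambda>p. (\<alpha> p, \<beta> p)"] that(2,3)
    by (auto intro: continuous_on_Pair)
  have jcV: "continuous_on S (\<lambda>p. s (apply_cper (V f (\<alpha> p)) (\<beta> p)))"
    if "bounded_linear s" "continuous_on S \<alpha>" "continuous_on S \<beta>"
    for s :: "complex \<times> complex \<Rightarrow> complex" and \<alpha> \<beta> :: "'c::topological_space \<Rightarrow> real" and S f
    using jc[OF continuous_on_component[OF V(1) that(1)] that(3,2)] .
  have Gc: "continuous_on S (\<lambda>p. G (\<alpha> p))" if "continuous_on S \<alpha>"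
    for \<alpha> :: "'c::topological_space \<Rightarrow> real" and S
    using continuous_on_compose2[OF G(1) that] by auto
  have kc: "continuous_on S (\<lambda>p. k1 (\<alpha> p) (\<beta> p) (\<gamma> p))" "continuous_on S (\<lambda>p. k2 (\<alpha> p) (\<beta> p) (\<gamma> p))"
    if "continuous_on S \<alpha>" "continuous_on S \<beta>" "continuous_on S \<gamma>"
    for \<alpha> \<beta> \<gamma> :: "'c::topological_space \<Rightarrow> real" and S
    unfolding k1_def k2_def by (intro continuous_intros jc[OF H(1)] jc[OF c1(1)] jc[OF c2(1)] Gc that)+
  have k_per: "k1 (x + 2 * pi) = k1 x" "k2 (x + 2 * pi) = k2 x" for x
  proof -
    have "G (x + 2 * pi - u) = G (x - u)" for u
      using G(2)[of "x - u"] by (simp add: algebra_simps)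
    then show "k1 (x + 2 * pi) = k1 x" "k2 (x + 2 * pi) = k2 x"
      by (simp_all add: k1_def k2_def fun_eq_iff H(2) c1(2) c2(2))
  qed
  define \<Phi> where "\<Phi> f x s u = k1 x s u * fst (apply_cper (V f s) u) + k2 x s u * snd (apply_cper (V f s) u)"
    for f x s u
  have rep: "R f x = integral {0..T} (\<lambda>s. integral {-pi..pi} (\<Phi> f x s))" for f x
  proof -
    \<comment> \<open>The integrating factor is normalized to 1 at time \<open>T\<close>: then
      \<open>?W T - ?W 0\<close> is exactly \<open>R f x\<close>, and in the derivative the terms
      with \<open>h\<close> cancel.\<close>
    let ?W = "\<lambda>t. exp (H x t - H x T) * sel (apply_cper (V f t) x)"
    have inner: "exp (H x t - H x T) * (c1 x t * coupling G (\<lambda>y. fst (apply_cper (V f t) y)) x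
          + c2 x t * coupling G (\<lambda>y. snd (apply_cper (V f t) y)) x) = integral {-pi..pi} (\<Phi> f x t)" for t
    proof -
      have "integral {-pi..pi} (\<Phi> f x t)
          = integral {-pi..pi} (\<lambda>u. k1 x t u * fst (apply_cper (V f t) u))
            + integral {-pi..pi} (\<lambda>u. k2 x t u * snd (apply_cper (V f t) u))"
        unfolding \<Phi>_def
        by (intro Henstock_Kurzweil_Integration.integral_add integrable_continuous_interval
            continuous_on_mult kc jcV bounded_linear_fst bounded_linear_snd continuous_on_const
            continuous_on_id)
      also have "integral {-pi..pi} (\<lambda>u. k1 x t u * fst (apply_cper (V f t) u))
          = integral {-pi..pi} (\<lambda>u. (exp (H x t - H x T) * c1 x t) * (of_real (G (x - u)) * fst (apply_cper (V f t) u)))"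
        by (simp add: k1_def ac_simps)
      also have "integral {-pi..pi} (\<lambda>u. k2 x t u * snd (apply_cper (V f t) u))
          = integral {-pi..pi} (\<lambda>u. (exp (H x t - H x T) * c2 x t) * (of_real (G (x - u)) * snd (apply_cper (V f t) u)))"
        by (simp add: k2_def ac_simps)
      finally show ?thesis
        unfolding coupling_def integral_mult_right by (simp add: distrib_left mult.assoc)
    qed
    have W: "(?W has_vector_derivative integral {-pi..pi} (\<Phi> f x t)) (at t)" for t
    proof -
      have "((\<lambda>t. H x t - H x T) has_vector_derivative h x t - 0) (at t)"
        by (intro has_vector_derivative_diff H_deriv) auto
      from field_vector_diff_chain_at[OF this DERIV_exp]
      have "((\<lambda>t. exp (H x t - H x T)) has_vector_derivative h x t * exp (H x t - H x T)) (at t)"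
        by (simp add: comp_def)
      from has_vector_derivative_mult[OF this V_deriv[of f x t]]
      show ?thesis by (simp add: inner[symmetric] algebra_simps)
    qed
    have "((\<lambda>t. integral {-pi..pi} (\<Phi> f x t)) has_integral ?W T - ?W 0) {0..T}"
      by (rule fundamental_theorem_of_calculus[OF T has_vector_derivative_at_within[OF W]])
    then show ?thesis
      by (simp add: integral_unique R_def int_h H(3) V(2))
  qed
  \<comment> \<open>The L1 distance, over time and one spatial period, of the kernels at
    \<open>x\<close> and \<open>y\<close>, multiplied by the bound \<open>C\<close> for the solution
    on \<open>{0..T}\<close>.\<close>
  define \<kappa> where "\<kappa> x y = C * integral {0..T} (\<lambda>s. integral {-pi..pi}
      (\<lambda>u. norm (k1 x s u - k1 y s u) + norm (k2 x s u - k2 y s u)))" for x y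
  show ?thesis
  proof (intro exI[of _ \<kappa>] conjI allI)
    show "continuous_on UNIV (\<lambda>x. \<kappa> x y)" for y
    proof -
      have "continuous_on UNIV (\<lambda>p. integral {-pi..pi}
          (\<lambda>u. norm (k1 (fst p) (snd p) u - k1 y (snd p) u) + norm (k2 (fst p) (snd p) u - k2 y (snd p) u)))"
        by (rule continuous_on_integral_param) (unfold case_prod_unfold, intro continuous_intros kc)
      then have "continuous_on UNIV (\<lambda>(x, s). integral {-pi..pi}
          (\<lambda>u. norm (k1 x s u - k1 y s u) + norm (k2 x s u - k2 y s u)))"
        by (simp add: case_prod_unfold)
      then show ?thesis
        unfolding \<kappa>_def by (intro continuous_on_mult continuous_on_const continuous_on_integral_param)
    qed
    show "\<kappa> (x + 2 * pi) y = \<kappa> x y" "\<kappa> x x = 0" for x y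
      by (simp_all add: \<kappa>_def k_per)
    show "norm (R f x - R f y) \<le> \<kappa> x y * norm f" for f x y
    proof -
      let ?r = "\<lambda>s u. norm (k1 x s u - k1 y s u) + norm (k2 x s u - k2 y s u)"
      have "norm (R f x - R f y) \<le> integral {0..T} (\<lambda>s. integral {-pi..pi} (\<lambda>u. ?r s u * (C * norm f)))"
        unfolding rep
      proof (rule iterated_integral_diff_le)
        show "continuous_on UNIV (\<lambda>(s, u). \<Phi> f x s u)" "continuous_on UNIV (\<lambda>(s, u). \<Phi> f y s u)"
          unfolding case_prod_unfold \<Phi>_def
          by (intro continuous_intros kc jcV bounded_linear_fst bounded_linear_snd)+
        show "continuous_on UNIV (\<lambda>(s, u). ?r s u * (C * norm f))"
          unfolding case_prod_unfold by (intro continuous_intros kc)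
        fix s u assume s: "s \<in> {0..T}"
        have b: "norm (fst (apply_cper (V f s) u)) \<le> C * norm f"
          "norm (snd (apply_cper (V f s) u)) \<le> C * norm f"
          using norm_apply_cper_le[of "V f s" u] V_bound[OF s, of f]
            norm_fst_le[of "fst (apply_cper (V f s) u)" "snd (apply_cper (V f s) u)"]
            norm_snd_le[of "snd (apply_cper (V f s) u)" "fst (apply_cper (V f s) u)"]
          by auto
        have "\<Phi> f x s u - \<Phi> f y s u = (k1 x s u - k1 y s u) * fst (apply_cper (V f s) u)
            + (k2 x s u - k2 y s u) * snd (apply_cper (V f s) u)"
          by (simp add: \<Phi>_def algebra_simps)
        also have "norm \<dots> \<le> norm (k1 x s u - k1 y s u) * (C * norm f) + norm (k2 x s u - k2 y s u) * (C * norm f)"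
          by (intro norm_triangle_mono) (simp_all add: norm_mult mult_left_mono b)
        finally show "norm (\<Phi> f x s u - \<Phi> f y s u) \<le> ?r s u * (C * norm f)"
          by (simp add: distrib_right)
      qed
      also have "\<dots> = \<kappa> x y * norm f" by (simp add: \<kappa>_def)
      finally show ?thesis .
    qed
  qed
qed

section \<open>The linearized system and its solutions\<close>

locale linearized_oscillators =
  fixes G :: "real \<Rightarrow> real" and \<alpha> \<Omega> T :: real and a :: "real \<Rightarrow> real \<Rightarrow> complex"
  assumes G: "continuous_on UNIV G" "\<And>x. G (x + 2 * pi) = G x"
    and T: "T > 0"
    and a: "continuous_on UNIV (\<lambda>(x, t). a x t)" "\<And>x t. a (x + 2 * pi) t = a x t"
      "\<And>x t. a x (t + T) = a x t"
begin

abbreviation \<eta> :: "real \<Rightarrow> real \<Rightarrow> complex" where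
  "\<eta> \<equiv> eta \<alpha> \<Omega> G a"

definition generator :: "real \<Rightarrow> cper \<Rightarrow> cper" where
  "generator t V = multiplication_part \<eta> t V + coupling_part \<alpha> G a t V"

text \<open>The four matrix entries of the coupling part, with the factor 1/2 included. The constant
  entries also take \<open>x\<close> and \<open>t\<close>, so that one variation of constants lemma
  serves both rows.\<close>

definition c11 :: "real \<Rightarrow> real \<Rightarrow> complex" where
  "c11 x t = 1/2 * exp (- \<i> * of_real \<alpha>)"
definition c12 :: "real \<Rightarrow> real \<Rightarrow> complex" where
  "c12 x t = - (1/2 * exp (\<i> * of_real \<alpha>) * (a x t)\<^sup>2)"
definition c21 :: "real \<Rightarrow> real \<Rightarrow> complex" where
  "c21 x t = - (1/2 * exp (- \<i> * of_real \<alpha>) * (cnj (a x t))\<^sup>2)"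
definition c22 :: "real \<Rightarrow> real \<Rightarrow> complex" where
  "c22 x t = 1/2 * exp (\<i> * of_real \<alpha>)"

lemmas c_defs = c11_def c12_def c21_def c22_def

lemma \<eta>_regular:
  "continuous_on UNIV (\<lambda>(x, t). \<eta> x t)" "\<eta> (x + 2 * pi) t = \<eta> x t" "\<eta> x (t + T) = \<eta> x t"
proof -
  show "continuous_on UNIV (\<lambda>(x, t). \<eta> x t)" by (rule eta_continuous[OF G(1) a(1)])
  show "\<eta> (x + 2 * pi) t = \<eta> x t" by (rule eta_periodic) (rule G a)+
  show "\<eta> x (t + T) = \<eta> x t" by (simp add: eta_def a(3))
qed

lemma cnj_\<eta>_regular:
  "continuous_on UNIV (\<lambda>(x, t). cnj (\<eta> x t))" "cnj (\<eta> (x + 2 * pi) t) = cnj (\<eta> x t)"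
  using \<eta>_regular by (auto simp: case_prod_unfold intro: continuous_intros)

lemma c_continuous:
  "continuous_on UNIV (\<lambda>(x, t). c11 x t)" "continuous_on UNIV (\<lambda>(x, t). c12 x t)"
  "continuous_on UNIV (\<lambda>(x, t). c21 x t)" "continuous_on UNIV (\<lambda>(x, t). c22 x t)"
  using a(1) unfolding c_defs case_prod_unfold by (auto intro!: continuous_intros)

lemma c_periodic:
  "c11 (x + 2 * pi) t = c11 x t" "c12 (x + 2 * pi) t = c12 x t"
  "c21 (x + 2 * pi) t = c21 x t" "c22 (x + 2 * pi) t = c22 x t"
  "c11 x (t + T) = c11 x t" "c12 x (t + T) = c12 x t"
  "c21 x (t + T) = c21 x t" "c22 x (t + T) = c22 x t"
  by (simp_all add: c_defs a)

abbreviation coupling1 :: "cper \<Rightarrow> real \<Rightarrow> complex" where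
  "coupling1 V \<equiv> coupling G (\<lambda>y. fst (apply_cper V y))"
abbreviation coupling2 :: "cper \<Rightarrow> real \<Rightarrow> complex" where
  "coupling2 V \<equiv> coupling G (\<lambda>y. snd (apply_cper V y))"

lemma apply_generator:
  "apply_cper (generator t V) x =
    (- \<eta> x t * fst (apply_cper V x) + (c11 x t * coupling1 V x + c12 x t * coupling2 V x),
     - cnj (\<eta> x t) * snd (apply_cper V x) + (c21 x t * coupling1 V x + c22 x t * coupling2 V x))"
  unfolding generator_def plus_cper.rep_eq apply_multiplication_part[OF \<eta>_regular(1,2)]
    apply_coupling_part[OF G a(1,2)] Let_def
  by (simp add: c_defs algebra_simps)

lemma fst_snd_continuous:
  "continuous_on UNIV (\<lambda>y. fst (apply_cper V y))" "continuous_on UNIV (\<lambda>y. snd (apply_cper V y))"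
  by (intro continuous_intros apply_cper_continuous)+

lemma generator_scaleC: "generator t (scaleC_cper c V) = scaleC_cper c (generator t V)"
  by (rule cper_eqI) (simp add: apply_generator scaleC_cper.rep_eq coupling_cmult algebra_simps)

lemma generator_linear: "linear (generator t)"
proof (rule linearI)
  show "generator t (U + V) = generator t U + generator t V" for U V
    by (rule cper_eqI)
      (simp add: apply_generator plus_cper.rep_eq coupling_add[OF G(1)] fst_snd_continuous algebra_simps)
  show "generator t (r *\<^sub>R V) = r *\<^sub>R generator t V" for r V
    by (metis generator_scaleC cper.scale_of_real)
qed

lemma generator_bounded: "\<exists>c\<ge>0. \<forall>t V. norm (generator t V) \<le> c * norm V"
proof -
  have "2 * pi > 0" by simp
  note bounded = doubly_periodic_bounded[OF _ this T]
  obtain b where b: "\<And>x t. norm (\<eta> x t) \<le> b" using bounded[OF \<eta>_regular] by blast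
  obtain b11 where b11: "\<And>x t. norm (c11 x t) \<le> b11"
    using bounded[OF c_continuous(1) c_periodic(1,5)] by blast
  obtain b12 where b12: "\<And>x t. norm (c12 x t) \<le> b12"
    using bounded[OF c_continuous(2) c_periodic(2,6)] by blast
  obtain b21 where b21: "\<And>x t. norm (c21 x t) \<le> b21"
    using bounded[OF c_continuous(3) c_periodic(3,7)] by blast
  obtain b22 where b22: "\<And>x t. norm (c22 x t) \<le> b22"
    using bounded[OF c_continuous(4) c_periodic(4,8)] by blast
  \<comment> \<open>\<open>G\<close> is viewed as constant in time, which lets the doubly periodic
    bound apply to it too.\<close>
  have "continuous_on UNIV (\<lambda>(x, t::real). G x)"
    unfolding case_prod_unfold by (intro continuous_on_compose2[OF G(1)] continuous_intros) auto
  then obtain g where g: "\<And>x. \<bar>G x\<bar> \<le> g"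
    using bounded[of "\<lambda>x t. G x"] G(2) by auto
  have nonneg: "b \<ge> 0" "b11 \<ge> 0" "b12 \<ge> 0" "b21 \<ge> 0" "b22 \<ge> 0" "g \<ge> 0"
    using order_trans[OF norm_ge_zero b] order_trans[OF norm_ge_zero b11]
      order_trans[OF norm_ge_zero b12] order_trans[OF norm_ge_zero b21]
      order_trans[OF norm_ge_zero b22] order_trans[OF abs_ge_zero g] by auto
  define c where "c = (b + (b11 * (2 * pi * g) + b12 * (2 * pi * g)))
    + (b + (b21 * (2 * pi * g) + b22 * (2 * pi * g)))"
  have "norm (generator t V) \<le> c * norm V" for t V
  proof (rule norm_cper_le)
    fix x
    have v: "norm (fst (apply_cper V y)) \<le> norm V" "norm (snd (apply_cper V y)) \<le> norm V" for y
      using norm_apply_cper_le[of V y] norm_fst_le[of "fst (apply_cper V y)" "snd (apply_cper V y)"]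
        norm_snd_le[of "snd (apply_cper V y)" "fst (apply_cper V y)"] by auto
    have cp: "norm (coupling1 V x) \<le> 2 * pi * g * norm V" "norm (coupling2 V x) \<le> 2 * pi * g * norm V"
      by (intro norm_coupling_le[OF G(1)] fst_snd_continuous g v)+
    have le: "norm (- h * u + (d * p + e * q)) \<le> (b + (d' * (2 * pi * g) + e' * (2 * pi * g))) * norm V"
      if "norm h \<le> b" "norm u \<le> norm V" "norm d \<le> d'" "norm e \<le> e'"
        "norm p \<le> 2 * pi * g * norm V" "norm q \<le> 2 * pi * g * norm V"
      for h u d p e q :: complex and d' e'
    proof -
      have "norm (- h * u + (d * p + e * q)) \<le> b * norm V + (d' * (2 * pi * g * norm V) + e' * (2 * pi * g * norm V))"
        using that nonneg order_trans[OF norm_ge_zero that(3)] order_trans[OF norm_ge_zero that(4)]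
        by (intro norm_triangle_mono) (auto simp: norm_mult intro!: mult_mono)
      then show ?thesis by (simp add: algebra_simps)
    qed
    have "norm (apply_cper (generator t V) x)
        \<le> norm (fst (apply_cper (generator t V) x)) + norm (snd (apply_cper (generator t V) x))"
      using norm_Pair_le[of "fst (apply_cper (generator t V) x)" "snd (apply_cper (generator t V) x)"]
      by simp
    also have "\<dots> \<le> (b + (b11 * (2 * pi * g) + b12 * (2 * pi * g))) * norm V
        + (b + (b21 * (2 * pi * g) + b22 * (2 * pi * g))) * norm V"
      unfolding apply_generator fst_conv snd_conv
      by (intro add_mono le b b11 b12 b21 b22 v cp) (simp add: b)
    also have "\<dots> = c * norm V" by (simp only: c_def distrib_right)
    finally show "norm (apply_cper (generator t V) x) \<le> c * norm V" .
  qed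
  moreover have "c \<ge> 0" unfolding c_def using nonneg by auto
  ultimately show ?thesis by blast
qed

lemma generator_continuous:
  assumes V: "continuous_on UNIV V"
  shows "continuous_on UNIV (\<lambda>t. generator t (V t))"
proof (rule continuous_on_cperI)
  have v: "continuous_on UNIV (\<lambda>(x, t). fst (apply_cper (V t) x))"
    "continuous_on UNIV (\<lambda>(x, t). snd (apply_cper (V t) x))"
    using continuous_on_component[OF V] bounded_linear_fst bounded_linear_snd by auto
  note cont = v coupling_continuous[OF G(1) v(1)] coupling_continuous[OF G(1) v(2)]
    \<eta>_regular(1) c_continuous
  show "continuous_on UNIV (\<lambda>(x, t). apply_cper (generator t (V t)) x)"
    unfolding apply_generator case_prod_unfold
    by (intro continuous_intros cont[unfolded case_prod_unfold])
qed

abbreviation solution :: "cper \<Rightarrow> real \<Rightarrow> cper" where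
  "solution f t \<equiv> evolution_operator generator t f"

lemma generator_bounded_linear_ode: "\<exists>c. bounded_linear_ode generator c"
proof -
  obtain c where "c \<ge> 0" "\<And>t V. norm (generator t V) \<le> c * norm V"
    using generator_bounded by blast
  then have "bounded_linear_ode generator c"
    by (intro bounded_linear_ode.intro generator_linear generator_continuous)
  then show ?thesis by blast
qed

lemma solution_solves: "solves_linear_ode generator f (solution f)"
  using generator_bounded_linear_ode bounded_linear_ode.solves_evolution_operator by blast

lemma solution_eq: "solves_linear_ode generator f V \<Longrightarrow> solution f t = V t"
  using generator_bounded_linear_ode bounded_linear_ode.evolution_operator_eq by blast

lemma solution_0: "solution f 0 = f"
  and solution_derivative: "(solution f has_vector_derivative generator t (solution f t)) (at t)"
  using solution_solves[of f] by (simp_all add: solves_linear_ode_def)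

lemma solution_continuous: "continuous_on UNIV (solution f)"
  using solution_derivative by (intro continuous_at_imp_continuous_on ballI)
    (auto intro: has_vector_derivative_continuous)

text \<open>By uniqueness: the sum of the two solutions solves the equation with the summed initial
  value. Complex homogeneity follows in the same way.\<close>

lemma solution_add: "solution (f + g) t = solution f t + solution g t"
proof (rule solution_eq)
  show "solves_linear_ode generator (f + g) (\<lambda>t. solution f t + solution g t)"
    unfolding solves_linear_ode_def linear_add[OF generator_linear]
    by (auto simp: solution_0 intro!: has_vector_derivative_add solution_derivative)
qed

lemma solution_scaleC: "solution (scaleC_cper c f) t = scaleC_cper c (solution f t)"
proof (rule solution_eq)
  show "solves_linear_ode generator (scaleC_cper c f) (\<lambda>t. scaleC_cper c (solution f t))"
    unfolding solves_linear_ode_def generator_scaleC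
    by (auto simp: solution_0 intro!: bounded_linear.has_vector_derivative[OF cper.bounded_linear_scale]
        solution_derivative)
qed

lemma solution_bounded: "\<exists>C. \<forall>f. \<forall>t\<in>{0..T}. norm (solution f t) \<le> C * norm f"
proof -
  obtain c where c: "bounded_linear_ode generator c" using generator_bounded_linear_ode by blast
  have "norm (solution f t) \<le> 2 * exp (2 * c * T) * norm f" if "t \<in> {0..T}" for f t
  proof -
    have "norm (solution f t) \<le> 2 * norm f * exp (2 * c * \<bar>t\<bar>)"
      by (rule bounded_linear_ode.solution_bound[OF c solution_solves])
    also have "\<dots> \<le> 2 * norm f * exp (2 * c * T)"
      using that bounded_linear_ode.c_nonneg[OF c] by (intro mult_left_mono) (auto intro: mult_left_mono)
    finally show ?thesis by (simp add: ac_simps)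
  qed
  then show ?thesis by blast
qed

section \<open>The two multipliers and the essential spectrum\<close>

definition multiplier :: "real \<Rightarrow> complex" where
  "multiplier x = exp (- integral {0..T} (\<eta> x))"

definition cnj_multiplier :: "real \<Rightarrow> complex" where
  "cnj_multiplier x = exp (- integral {0..T} (\<lambda>t. cnj (\<eta> x t)))"

lemma multiplier_regular:
  "continuous_on UNIV multiplier" "multiplier (x + 2 * pi) = multiplier x"
  "continuous_on UNIV cnj_multiplier" "cnj_multiplier (x + 2 * pi) = cnj_multiplier x"
proof -
  have "\<eta> (x + 2 * pi) = \<eta> x" using \<eta>_regular(2) by blast
  then show "multiplier (x + 2 * pi) = multiplier x" "cnj_multiplier (x + 2 * pi) = cnj_multiplier x"
    by (simp_all add: multiplier_def cnj_multiplier_def)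
  show "continuous_on UNIV multiplier" "continuous_on UNIV cnj_multiplier"
    unfolding multiplier_def cnj_multiplier_def
    by (intro continuous_intros continuous_on_integral_param \<eta>_regular cnj_\<eta>_regular)+
qed

theorem essential_spectrum_monodromy:
  "cper.essential_spectrum (monodromy \<alpha> \<Omega> G a T) = range multiplier \<union> range cnj_multiplier"
proof -
  obtain C where bound: "\<And>f t. t \<in> {0..T} \<Longrightarrow> norm (solution f t) \<le> C * norm f"
    using solution_bounded by blast
  have T0: "T \<ge> 0" using T by simp
  have der1: "((\<lambda>t. fst (apply_cper (solution f t) x)) has_vector_derivative
      - \<eta> x t * fst (apply_cper (solution f t) x)
      + (c11 x t * coupling1 (solution f t) x + c12 x t * coupling2 (solution f t) x)) (at t)" for f x t
    using bounded_linear.has_vector_derivative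
      [OF bounded_linear_compose[OF bounded_linear_fst bounded_linear_apply_cper] solution_derivative]
    by (simp add: apply_generator)
  have der2: "((\<lambda>t. snd (apply_cper (solution f t) x)) has_vector_derivative
      - cnj (\<eta> x t) * snd (apply_cper (solution f t) x)
      + (c21 x t * coupling1 (solution f t) x + c22 x t * coupling2 (solution f t) x)) (at t)" for f x t
    using bounded_linear.has_vector_derivative
      [OF bounded_linear_compose[OF bounded_linear_snd bounded_linear_apply_cper] solution_derivative]
    by (simp add: apply_generator)
  let ?M = "mult_cper multiplier cnj_multiplier"
  \<comment> \<open>Taken as the difference, so the decomposition of the monodromy operator is
    immediate; the content lies in its two components, which are the remainders \<open>R\<close> of
    \<open>variation_of_constants_modulus\<close>.\<close>
  define K where "K f = solution f T - ?M f" for f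
  have aK: "apply_cper (K f) x = (fst (apply_cper (solution f T) x) - multiplier x * fst (apply_cper f x),
      snd (apply_cper (solution f T) x) - cnj_multiplier x * snd (apply_cper f x))" for f x
    by (simp add: K_def minus_cper.rep_eq apply_mult_cper multiplier_regular prod_eq_iff)
  obtain \<kappa>1 where \<kappa>1: "\<And>y. continuous_on UNIV (\<lambda>x. \<kappa>1 x y)" "\<And>x y. \<kappa>1 (x + 2 * pi) y = \<kappa>1 x y"
    "\<And>x. \<kappa>1 x x = 0"
    "\<And>f x y. norm (fst (apply_cper (K f) x) - fst (apply_cper (K f) y)) \<le> \<kappa>1 x y * norm f"
    using variation_of_constants_modulus[OF \<eta>_regular(1,2) c_continuous(1) c_periodic(1)
        c_continuous(2) c_periodic(2) G T0 solution_continuous solution_0 bound der1]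
    unfolding aK multiplier_def fst_conv by blast
  obtain \<kappa>2 where \<kappa>2: "\<And>y. continuous_on UNIV (\<lambda>x. \<kappa>2 x y)" "\<And>x y. \<kappa>2 (x + 2 * pi) y = \<kappa>2 x y"
    "\<And>x. \<kappa>2 x x = 0"
    "\<And>f x y. norm (snd (apply_cper (K f) x) - snd (apply_cper (K f) y)) \<le> \<kappa>2 x y * norm f"
    using variation_of_constants_modulus[OF cnj_\<eta>_regular c_continuous(3) c_periodic(3)
        c_continuous(4) c_periodic(4) G T0 solution_continuous solution_0 bound der2]
    unfolding aK cnj_multiplier_def snd_conv by blast
  have bE: "bounded_linear (\<lambda>f. solution f T)"
  proof (rule bounded_linear_intro[where K = C])
    show "solution (r *\<^sub>R f) T = r *\<^sub>R solution f T" for r f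
      by (metis solution_scaleC cper.scale_of_real)
    show "norm (solution f T) \<le> norm f * C" for f using bound[of T f] T0 by (simp add: mult.commute)
  qed (rule solution_add)
  \<comment> \<open>The norm of a pair is at most the sum of the norms of its components, so the two
    moduli are added.\<close>
  interpret multiplication_plus_equicontinuous multiplier cnj_multiplier K "\<lambda>x y. \<kappa>1 x y + \<kappa>2 x y"
  proof (rule multiplication_plus_equicontinuous.intro)
    show "bounded_linear K"
      unfolding K_def by (intro bounded_linear_sub bE bounded_linear_mult_cper multiplier_regular)
    show "K (scaleC_cper c f) = scaleC_cper c (K f)" for c f
      by (simp add: K_def solution_scaleC mult_cper_scaleC multiplier_regular cper.scale_right_diff_distrib)
    show "continuous_on UNIV (\<lambda>x. \<kappa>1 x y + \<kappa>2 x y)" for y by (intro continuous_intros \<kappa>1 \<kappa>2)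
    show "norm (apply_cper (K f) x - apply_cper (K f) y) \<le> (\<kappa>1 x y + \<kappa>2 x y) * norm f" for f x y
    proof -
      have "apply_cper (K f) x - apply_cper (K f) y
          = (fst (apply_cper (K f) x) - fst (apply_cper (K f) y), snd (apply_cper (K f) x) - snd (apply_cper (K f) y))"
        by (simp add: prod_eq_iff)
      then show ?thesis
        using norm_Pair_le[of "fst (apply_cper (K f) x) - fst (apply_cper (K f) y)"
            "snd (apply_cper (K f) x) - snd (apply_cper (K f) y)"] \<kappa>1(4)[of f x y] \<kappa>2(4)[of f x y]
        by (simp add: distrib_right)
    qed
  qed (simp_all add: multiplier_regular \<kappa>1 \<kappa>2)
  have "monodromy \<alpha> \<Omega> G a T = (\<lambda>f. ?M f + K f)"
    unfolding monodromy_def generator_def[abs_def, symmetric] by (auto simp: K_def)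
  then show ?thesis using essential_spectrum_eq by simp
qed

end

theorem mainTheorem8:
  fixes G :: "real \<Rightarrow> real" and \<alpha> \<Omega> T :: real and a z :: "real \<Rightarrow> real \<Rightarrow> complex"
  assumes G_continuous: "continuous_on UNIV G"
    and G_nonconstant: "\<exists>x y. G x \<noteq> G y"
    and G_even: "\<And>x. G (- x) = G x"
    and G_periodic: "\<And>x. G (x + 2 * pi) = G x"
    and alpha: "\<alpha> \<in> {- pi / 2 <..< pi / 2}"
    and T_pos: "T > 0"
    and a_continuous: "continuous_on UNIV (\<lambda>(x, t). a x t)"
    and a_periodic_x: "\<And>x t. a (x + 2 * pi) t = a x t"
    and a_periodic_t: "\<And>x t. a x (t + T) = a x t"
    and z_def: "\<And>x t. z x t = a x t * exp (\<i> * of_real \<Omega> * of_real t)"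
    and z_solution: "oscillator_solution \<alpha> G z"
  shows "cper.essential_spectrum (monodromy \<alpha> \<Omega> G a T) =
      {exp (- integral {0..T} (\<lambda>t. eta \<alpha> \<Omega> G a x t)) | x. x \<in> {- pi..pi}} \<union>
      {exp (- integral {0..T} (\<lambda>t. cnj (eta \<alpha> \<Omega> G a x t))) | x. x \<in> {- pi..pi}}"
proof -
  interpret linearized_oscillators G \<alpha> \<Omega> T a
    by unfold_locales (fact assms)+
  \<comment> \<open>Every value of a \<open>2 * pi\<close>-periodic function is attained on the
    closed period, which turns ranges over the line into the sets of the statement.\<close>
  have restrict: "range m = {m x | x. x \<in> {-pi..pi}}" if "\<And>x. m (x + 2 * pi) = m x"
    for m :: "real \<Rightarrow> complex"
    using periodic_obtain[of m] that by (auto simp: image_iff) metis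
  show ?thesis
    unfolding essential_spectrum_monodromy restrict[of multiplier, OF multiplier_regular(2)]
      restrict[of cnj_multiplier, OF multiplier_regular(4)]
    unfolding multiplier_def cnj_multiplier_def by simp
qed

end
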